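(* Fix a positive integer $d$. There is an algorithm which, given a matroid $M=(N,\mathcal{B})$ on $N=\{1,\dots,n\}$ presented by an independence oracle, a weighting $w:N\to\mathbb{R}^d$ (given explicitly), and a convex functional $c:\mathbb{R}^d\to\mathbb{R}$ presented by an evaluation oracle, outputs a basis $B\in\mathcal{B}$ maximizing $c(w(B))$ over all bases of $M$. The algorithm uses $O(n^{2d-1}\log n)$ real arithmetic operations and oracle queries; in particular, for every fixed $d$ the convex matroid optimization problem is solvable in polynomial oracle time.
   Context: A matroid $M=(N,\mathcal{B})$ on ground set $N=\{1,\dots,n\}$ is given by its collection of bases $\mathcal{B}\subseteq 2^N$. For $J\subseteq N$, $w(J):=\sum_{j\in J}w(j)$, with $w(\emptyset)=0$. An independence oracle for $M$ answers, for a queried $J\subseteq N$, whether $J$ is an independent set of $M$ (a subset of some basis). An evaluation oracle for $c$ returns $c(x)$ for a queried $x\in\mathbb{R}^d$. The convex matroid optimization problem is: given $M,w,c$, find a basis $B\in\mathcal{B}$ maximizing $c(w(B))$. Complexity is measured by the number of real arithmetic operations (including comparisons) and oracle queries; the constant in the $O(\cdot)$ may depend on $d$. *)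

theory Defs
  imports "HOL-Analysis.Analysis" "HOL-Library.Landau_Symbols"
begin

section \<open>Matroids and convex matroid optimization\<close>

definition matroid :: "nat set \<Rightarrow> nat set set \<Rightarrow> bool" where
  "matroid N \<B> \<longleftrightarrow>
     finite N \<and> \<B> \<subseteq> Pow N \<and> \<B> \<noteq> {} \<and>
     (\<forall>A\<in>\<B>. \<forall>B\<in>\<B>. \<forall>a\<in>A - B. \<exists>b\<in>B - A. insert b (A - {a}) \<in> \<B>)"

definition indep :: "nat set set \<Rightarrow> nat set \<Rightarrow> bool" where
  "indep \<B> J \<longleftrightarrow> (\<exists>B\<in>\<B>. J \<subseteq> B)"

definition optimal_basis ::
    "nat set set \<Rightarrow> (nat \<Rightarrow> real ^ 'd) \<Rightarrow> (real ^ 'd \<Rightarrow> real) \<Rightarrow> nat set \<Rightarrow> bool" where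
  "optimal_basis \<B> w c B \<longleftrightarrow>
     B \<in> \<B> \<and> (\<forall>B'\<in>\<B>. c (\<Sum>j\<in>B'. w j) \<le> c (\<Sum>j\<in>B. w j))"


section \<open>A real RAM with oracles\<close>

text \<open>
  Algorithms are programs of a fixed finite syntax (real constants are integers, there is no
  rounding, and reals never flow into index computations except through comparisons).
  Memory consists of index variables, index arrays and arrays of reals, each named by a
  natural number.
\<close>

record mem =
  ivar :: "nat \<Rightarrow> nat"
  iarr :: "nat \<Rightarrow> nat \<Rightarrow> nat"
  rarr :: "nat \<Rightarrow> nat \<Rightarrow> real"

text \<open>
  Index arithmetic has no multiplication, so indices computed in polynomially many steps
  have polynomially many bits.
\<close>

datatype iexp =
    IConst nat
  | IVar nat
  | IGet nat iexp
  | IAdd iexp iexp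
  | ISub iexp iexp

datatype rexp =
    RConst int
  | RGet nat iexp
  | RAdd rexp rexp
  | RSub rexp rexp
  | RMul rexp rexp
  | RDiv rexp rexp

datatype bexp =
    ILess iexp iexp
  | RLess rexp rexp

datatype com =
    SKIP
  | ISet nat iexp
  | IPut nat iexp iexp
  | RPut nat iexp rexp
  | INDEP nat nat
  | EVAL nat iexp nat
  | SEQ com com
  | COND bexp com com
  | WHILE bexp com

primrec ival :: "iexp \<Rightarrow> mem \<Rightarrow> nat" where
  "ival (IConst k) s = k"
| "ival (IVar x) s = ivar s x"
| "ival (IGet a e) s = iarr s a (ival e s)"
| "ival (IAdd e f) s = ival e s + ival f s"
| "ival (ISub e f) s = ival e s - ival f s"

text \<open>
  Division by zero returns zero, as in HOL; a program can exclude it by a preceding test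
  at constant cost.
\<close>

primrec rval :: "rexp \<Rightarrow> mem \<Rightarrow> real" where
  "rval (RConst k) s = of_int k"
| "rval (RGet a e) s = rarr s a (ival e s)"
| "rval (RAdd e f) s = rval e s + rval f s"
| "rval (RSub e f) s = rval e s - rval f s"
| "rval (RMul e f) s = rval e s * rval f s"
| "rval (RDiv e f) s = rval e s / rval f s"

primrec bval :: "bexp \<Rightarrow> mem \<Rightarrow> bool" where
  "bval (ILess e f) s \<longleftrightarrow> ival e s < ival f s"
| "bval (RLess e f) s \<longleftrightarrow> rval e s < rval f s"

primrec rcost :: "rexp \<Rightarrow> nat" where
  "rcost (RConst k) = 0"
| "rcost (RGet a e) = 0"
| "rcost (RAdd e f) = 1 + rcost e + rcost f"
| "rcost (RSub e f) = 1 + rcost e + rcost f"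
| "rcost (RMul e f) = 1 + rcost e + rcost f"
| "rcost (RDiv e f) = 1 + rcost e + rcost f"

primrec bcost :: "bexp \<Rightarrow> nat" where
  "bcost (ILess e f) = 0"
| "bcost (RLess e f) = 1 + rcost e + rcost f"

definition iarr_set :: "nat \<Rightarrow> mem \<Rightarrow> nat set" where
  "iarr_set a s = {j. iarr s a j \<noteq> 0}"

definition put_ivar :: "nat \<Rightarrow> nat \<Rightarrow> mem \<Rightarrow> mem" where
  "put_ivar x v s = s\<lparr>ivar := (ivar s)(x := v)\<rparr>"

definition put_iarr :: "nat \<Rightarrow> nat \<Rightarrow> nat \<Rightarrow> mem \<Rightarrow> mem" where
  "put_iarr a i v s = s\<lparr>iarr := (iarr s)(a := (iarr s a)(i := v))\<rparr>"

definition put_rarr :: "nat \<Rightarrow> nat \<Rightarrow> real \<Rightarrow> mem \<Rightarrow> mem" where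
  "put_rarr a i v s = s\<lparr>rarr := (rarr s)(a := (rarr s a)(i := v))\<rparr>"

text \<open>
  \<open>run ind ev P s q t s'\<close>: with independence oracle \<open>ind\<close> and evaluation oracle \<open>ev\<close>,
  program \<open>P\<close> started in \<open>s\<close> halts in \<open>s'\<close> after \<open>q\<close> real arithmetic operations, real
  comparisons and oracle queries. The counter \<open>t\<close> is the total number of commands and tests
  executed, index bookkeeping included; since the expressions of a fixed program have bounded
  size, each of these is a bounded number of elementary operations.

  An independence query \<open>INDEP x a\<close> is about the set with characteristic vector array \<open>a\<close>; an
  evaluation query \<open>EVAL a e b\<close> is about the point whose coordinates are the initial cells of
  array \<open>b\<close>.
\<close>

inductive run ::
    "(nat set \<Rightarrow> bool) \<Rightarrow> ((nat \<Rightarrow> real) \<Rightarrow> real) \<Rightarrow>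
      com \<Rightarrow> mem \<Rightarrow> nat \<Rightarrow> nat \<Rightarrow> mem \<Rightarrow> bool"
  for ind ev where
  Skip: "run ind ev SKIP s 0 1 s"
| ISet: "run ind ev (ISet x e) s 0 1 (put_ivar x (ival e s) s)"
| IPut: "run ind ev (IPut a e f) s 0 1 (put_iarr a (ival e s) (ival f s) s)"
| RPut: "run ind ev (RPut a e f) s (rcost f) 1 (put_rarr a (ival e s) (rval f s) s)"
| Indep: "run ind ev (INDEP x a) s 1 1
            (put_ivar x (if ind (iarr_set a s) then 1 else 0) s)"
| Eval: "run ind ev (EVAL a e b) s 1 1 (put_rarr a (ival e s) (ev (rarr s b)) s)"
| Seq: "run ind ev P s q t s' \<Longrightarrow> run ind ev Q s' q' t' s'' \<Longrightarrow>
          run ind ev (SEQ P Q) s (q + q') (t + t') s''"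
| CondTrue: "bval b s \<Longrightarrow> run ind ev P s q t s' \<Longrightarrow>
          run ind ev (COND b P Q) s (bcost b + q) (1 + t) s'"
| CondFalse: "\<not> bval b s \<Longrightarrow> run ind ev Q s q t s' \<Longrightarrow>
          run ind ev (COND b P Q) s (bcost b + q) (1 + t) s'"
| WhileFalse: "\<not> bval b s \<Longrightarrow> run ind ev (WHILE b P) s (bcost b) 1 s"
| WhileTrue: "bval b s \<Longrightarrow> run ind ev P s q t s' \<Longrightarrow>
          run ind ev (WHILE b P) s' q' t' s'' \<Longrightarrow>
          run ind ev (WHILE b P) s (bcost b + q + q') (1 + t + t') s''"

lemma run_deterministic:
  assumes "run ind ev P s q t s'" and "run ind ev P s q2 t2 s2"
  shows "q2 = q \<and> t2 = t \<and> s2 = s'"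
  using assms
proof (induction arbitrary: q2 t2 s2 rule: run.induct)
  case (Skip s)
  then show ?case by cases simp
next
  case (ISet x e s)
  then show ?case by cases simp
next
  case (IPut a e f s)
  then show ?case by cases simp
next
  case (RPut a e f s)
  then show ?case by cases simp
next
  case (Indep x a s)
  then show ?case by cases simp
next
  case (Eval a e b s)
  then show ?case by cases simp
next
  case (Seq P s q t s' Q q' t' s'')
  note IH = Seq.IH
  from Seq.prems show ?case
  proof cases
    case (Seq q1 t1 u q1' t1')
    from IH(1)[OF this(3)] have "q1 = q" "t1 = t" "u = s'" by simp_all
    moreover from this Seq(4) have "q1' = q' \<and> t1' = t' \<and> s2 = s''" by (intro IH(2)) simp
    ultimately show ?thesis using Seq(1,2) by simp
  qed
next
  case (CondTrue b s P q t s' Q)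
  note IH = CondTrue.IH and tst = CondTrue.hyps(1)
  from CondTrue.prems show ?case
  proof cases
    case (CondTrue q1 t1)
    with IH[OF CondTrue(4)] show ?thesis by simp
  next
    case CondFalse
    with tst show ?thesis by simp
  qed
next
  case (CondFalse b s Q q t s' P)
  note IH = CondFalse.IH and tst = CondFalse.hyps(1)
  from CondFalse.prems show ?case
  proof cases
    case CondTrue
    with tst show ?thesis by simp
  next
    case (CondFalse q1 t1)
    with IH[OF CondFalse(4)] show ?thesis by simp
  qed
next
  case (WhileFalse b s P)
  from WhileFalse.prems WhileFalse.hyps show ?case
    by cases auto
next
  case (WhileTrue b s P q t s' q' t' s'')
  note IH = WhileTrue.IH and tst = WhileTrue.hyps(1)
  from WhileTrue.prems show ?case
  proof cases
    case WhileFalse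
    with tst show ?thesis by simp
  next
    case (WhileTrue q1 t1 u q1' t1')
    from IH(1)[OF this(4)] have "q1 = q" "t1 = t" "u = s'" by simp_all
    moreover from this WhileTrue(5) have "q1' = q' \<and> t1' = t' \<and> s2 = s''" by (intro IH(2)) simp
    ultimately show ?thesis using WhileTrue(1,2) by simp
  qed
qed


section \<open>Presentation of the input\<close>

text \<open>
  The coordinates of a vector in \<open>real ^ 'd\<close> are laid out in memory along a numbering
  \<open>ix :: 'd \<Rightarrow> nat\<close>, a bijection onto \<open>{..<CARD('d)}\<close>. Initially index variable \<open>0\<close> holds \<open>n\<close>,
  real array \<open>ix i\<close> holds the coordinate \<open>i\<close> of \<open>w 1, \<dots>, w n\<close> in its cells \<open>1, \<dots>, n\<close>, and
  everything else is zero.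
\<close>

definition init_mem :: "('d::finite \<Rightarrow> nat) \<Rightarrow> nat \<Rightarrow> (nat \<Rightarrow> real ^ 'd) \<Rightarrow> mem" where
  "init_mem ix n w =
     \<lparr>ivar = (\<lambda>x. if x = 0 then n else 0),
      iarr = (\<lambda>a j. 0),
      rarr = (\<lambda>a j. if a < CARD('d) \<and> j \<in> {1..n} then w j $ inv ix a else 0)\<rparr>"

definition eval_oracle ::
    "('d::finite \<Rightarrow> nat) \<Rightarrow> (real ^ 'd \<Rightarrow> real) \<Rightarrow> (nat \<Rightarrow> real) \<Rightarrow> real" where
  "eval_oracle ix c f = c (\<chi> i. f (ix i))"

text \<open>The output is the set whose characteristic vector is index array \<open>0\<close> of the final memory.\<close>

definition solves_within ::
    "('d::finite \<Rightarrow> nat) \<Rightarrow> com \<Rightarrow> nat \<Rightarrow> nat set set \<Rightarrow> (nat \<Rightarrow> real ^ 'd) \<Rightarrow>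
      (real ^ 'd \<Rightarrow> real) \<Rightarrow> nat \<Rightarrow> nat \<Rightarrow> bool" where
  "solves_within ix P n \<B> w c qmax tmax \<longleftrightarrow>
     (\<exists>q t s. run (indep \<B>) (eval_oracle ix c) P (init_mem ix n w) q t s \<and>
        optimal_basis \<B> w c (iarr_set 0 s) \<and> q \<le> qmax \<and> t \<le> tmax)"

end

(*
  A maximizer of a convex c over the points w(B) can be taken at an extreme point v of their
  convex hull, and v is the unique maximizer of some linear functional l, which may be perturbed
  off all the hyperplanes orthogonal to the differences g = w i - w j. The greedy algorithm run on
  the order induced by l therefore finds an optimal basis, and only the chamber of l in this
  arrangement matters. A chamber has a flag of faces, obtained by moving l to a nearest hyperplane
  g^perp, then moving inside g^perp, and so on. The flag is described by d - 1 ordered pairs (i, j)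
  together with a pivot row at each level and one final sign, so O(n^(2d-2)) choices exhaust all
  chambers, degenerate configurations included. Each choice yields d linear functionals whose
  lexicographic order induces the order of the chamber, and costs one sort and one greedy run,
  O(n log n). Choices that do not come from a flag do no harm, since greedy returns a basis
  for every order.
*)
theory Submission
  imports Defs "HOL-Real_Asymp.Real_Asymp"
begin

section \<open>Flags of a hyperplane arrangement\<close>

text \<open>The lexicographic order stands for the infinitesimal perturbation
  \<open>k1 + \<epsilon> k2 + \<epsilon>^2 k3 + ...\<close>: it recovers a functional inside the
  chamber from its flag without any bound on \<epsilon>. Naming d - 1 hyperplanes through a common
  line would call for independent normals; projecting level by level tolerates every degeneracy,
  because each level gets a choice of its own, possibly a dummy one. Neither the sought functional
  nor any functional of the flag is computed as a vector. A row \<open>r\<close> is present only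
  through the numbers \<open>r \<bullet> w j\<close>, which are all that projection and comparison
  read, so one projection costs O(n). The pair is ordered because replacing \<open>g\<close> by
  \<open>- g\<close> negates the pivot and nothing else: the sign tells on which side of the wall
  the chamber lies. The last face is a line, which leaves one more sign. Index moves are not charged
  against \<open>n^(2d-1) log n\<close>, so a sort with few comparisons and many moves is good
  enough; the second counter only has to be polynomial.\<close>

primrec lexpos :: "'a::real_inner list \<Rightarrow> 'a \<Rightarrow> bool" where
  "lexpos [] h \<longleftrightarrow> False"
| "lexpos (k # ks) h \<longleftrightarrow> k \<bullet> h > 0 \<or> k \<bullet> h = 0 \<and> lexpos ks h"

text \<open>One \<open>f\<close> is repaired at a time: along \<open>v + t *\<^sub>R u\<close> with
  \<open>u \<bullet> f \<noteq> 0\<close>, the strict conditions reached so far persist for small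
  \<open>t > 0\<close>, and if \<open>v \<bullet> f = 0\<close>, the value at \<open>f\<close>
  becomes \<open>t * (u \<bullet> f)\<close>. The subspace \<open>U\<close> allows the perturbation
  to stay inside the span of a face.\<close>

lemma generic_perturb:
  fixes U :: "'a::real_inner set"
  assumes "finite F" "finite P" "subspace U" "a \<in> U" "\<forall>p\<in>P. a \<bullet> p > 0"
    and "\<forall>f\<in>F. \<exists>u\<in>U. u \<bullet> f \<noteq> 0"
  shows "\<exists>v\<in>U. (\<forall>f\<in>F. v \<bullet> f \<noteq> 0) \<and> (\<forall>p\<in>P. v \<bullet> p > 0)"
  using assms(1,6)
proof (induction F rule: finite_induct)
  case empty
  then show ?case using assms by auto
next
  case (insert f F)
  then obtain v where v: "v \<in> U" "\<forall>f\<in>F. v \<bullet> f \<noteq> 0" "\<forall>p\<in>P. v \<bullet> p > 0" by auto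
  from insert obtain u where u: "u \<in> U" "u \<bullet> f \<noteq> 0" by auto
  have lim: "((\<lambda>t. (v + t *\<^sub>R u) \<bullet> x) \<longlongrightarrow> v \<bullet> x) (at_right 0)" for x
  proof -
    have "((\<lambda>t. (v + t *\<^sub>R u) \<bullet> x) \<longlongrightarrow> (v + 0 *\<^sub>R u) \<bullet> x) (at_right 0)"
      by (intro tendsto_intros)
    then show ?thesis by simp
  qed
  have 1: "eventually (\<lambda>t. (v + t *\<^sub>R u) \<bullet> x \<noteq> 0) (at_right 0)" if "v \<bullet> x \<noteq> 0" for x
    using tendsto_imp_eventually_ne[OF lim that] .
  have 2: "eventually (\<lambda>t. (v + t *\<^sub>R u) \<bullet> x > 0) (at_right 0)" if "v \<bullet> x > 0" for x
    using order_tendstoD(1)[OF lim that] .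
  have 3: "eventually (\<lambda>t. (v + t *\<^sub>R u) \<bullet> f \<noteq> 0) (at_right (0::real))"
  proof (cases "v \<bullet> f = 0")
    case True
    have "eventually (\<lambda>t::real. t > 0) (at_right 0)" by (rule eventually_at_right_less)
    then show ?thesis by eventually_elim (use True u in \<open>simp add: inner_add_left\<close>)
  qed (rule 1)
  have "eventually (\<lambda>t. (\<forall>x\<in>F. (v + t *\<^sub>R u) \<bullet> x \<noteq> 0) \<and> (\<forall>x\<in>P. (v + t *\<^sub>R u) \<bullet> x > 0)
      \<and> (v + t *\<^sub>R u) \<bullet> f \<noteq> 0) (at_right 0)"
    using v 1 2 3 insert.hyps assms(2)
    by (intro eventually_conj eventually_ball_finite) auto
  then obtain t where "(\<forall>x\<in>F. (v + t *\<^sub>R u) \<bullet> x \<noteq> 0) \<and> (\<forall>x\<in>P. (v + t *\<^sub>R u) \<bullet> x > 0)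
      \<and> (v + t *\<^sub>R u) \<bullet> f \<noteq> 0"
    using eventually_happens'[OF trivial_limit_at_right_real] by blast
  moreover have "v + t *\<^sub>R u \<in> U"
    using u v assms(3) by (simp add: subspace_add subspace_scale)
  ultimately show ?case by (metis insert_iff)
qed

section \<open>Convex maximization over a finite set of points\<close>

lemma finite_has_maximizer:
  fixes f :: "'a \<Rightarrow> 'b::linorder"
  assumes "finite S" "S \<noteq> {}"
  obtains v where "v \<in> S" "\<And>y. y \<in> S \<Longrightarrow> f y \<le> f v"
proof -
  have "Max (f ` S) \<in> f ` S" using assms by simp
  then obtain v where "v \<in> S" "f v = Max (f ` S)" by (metis imageE)
  then show ?thesis using assms that by simp
qed

text \<open>A convex function on the hull is bounded by its maximum over the extreme points, so some
  extreme point \<open>v\<close> is a maximizer. It is even exposed, because the hull of the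
  remaining points is closed and misses \<open>v\<close>.\<close>

lemma convex_max_exposed:
  fixes S :: "'a::euclidean_space set"
  assumes "finite S" "S \<noteq> {}" "convex_on UNIV c"
  shows "\<exists>v\<in>S. \<exists>l. (\<forall>y\<in>S. c y \<le> c v) \<and> (\<forall>y\<in>S - {v}. l \<bullet> (v - y) > 0)"
proof -
  let ?K = "convex hull S"
  define E where "E = {x. x extreme_point_of ?K}"
  have K: "compact ?K" "convex ?K" using assms by (auto intro: finite_imp_compact_convex_hull)
  have ES: "E \<subseteq> S" unfolding E_def using extreme_point_of_convex_hull by blast
  have hull: "?K = convex hull E" unfolding E_def using Krein_Milman_Minkowski K by blast
  have E: "finite E" "E \<noteq> {}"
    using ES assms hull finite_subset by (blast, auto)
  obtain v where v: "v \<in> E" "\<forall>y\<in>E. c y \<le> c v"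
    using finite_has_maximizer[OF E, of c] by metis
  have "\<forall>y\<in>convex hull E. c y \<le> c v"
    using v(2) by (intro convex_on_convex_hull_bound convex_on_subset[OF assms(3)]) auto
  then have mx: "\<forall>y\<in>S. c y \<le> c v" by (simp flip: hull add: hull_inc)
  have vK: "v extreme_point_of ?K" using v by (simp add: E_def)
  \<comment> \<open>Deleting an extreme point leaves a convex set convex, so the hull of the other
    points stays inside \<open>?K - {v}\<close>.\<close>
  then have "convex (?K - {v})"
    using extreme_point_of_stillconvex K by blast
  then have "convex hull (S - {v}) \<subseteq> ?K - {v}"
    using hull_subset[of S convex] by (intro hull_minimal) auto
  then have "v \<notin> convex hull (S - {v})" by blast
  moreover have "closed (convex hull (S - {v}))" 
    using assms by (simp add: finite_imp_compact_convex_hull compact_imp_closed)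
  ultimately obtain l b where lb: "l \<bullet> v < b" "\<forall>x\<in>convex hull (S - {v}). l \<bullet> x > b"
    using separating_hyperplane_closed_point[of "convex hull (S - {v})" v] by auto
  \<comment> \<open>The separation puts \<open>v\<close> on the low side of \<open>l\<close>, hence
    the sign.\<close>
  have "\<forall>y\<in>S - {v}. (-l) \<bullet> (v - y) > 0"
  proof
    fix y assume "y \<in> S - {v}"
    then have "y \<in> convex hull (S - {v})" by (rule hull_inc)
    then show "(-l) \<bullet> (v - y) > 0" using lb by (force simp: inner_diff_right)
  qed
  then show ?thesis using v ES mx by blast
qed

text \<open>
  Here \<open>D\<close> is the set of normals of the arrangement, \<open>span (set rs)\<close> is the linear span of the
  current face of the flag, \<open>m\<close> is a point in the relative interior of that face, and \<open>ks\<close> are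
  the functionals already retired, the most significant one first.
\<close>

definition chamber_inv :: "'a::euclidean_space set \<Rightarrow> 'a \<Rightarrow> 'a list \<Rightarrow> 'a list \<Rightarrow> bool" where
  "chamber_inv D l rs ks \<longleftrightarrow> (\<exists>m\<in>span (set rs).
     (\<forall>h\<in>D. m \<bullet> h = 0 \<longrightarrow> (\<forall>r\<in>set rs. r \<bullet> h = 0)) \<and>
     (\<forall>h\<in>D. l \<bullet> h > 0 \<longrightarrow> m \<bullet> h > 0 \<or> m \<bullet> h = 0 \<and> lexpos ks h))"

section \<open>Projection of a face along a pivot row\<close>

definition drop_nth :: "nat \<Rightarrow> 'a list \<Rightarrow> 'a list" where
  "drop_nth p xs = take p xs @ drop (Suc p) xs"

lemma set_drop_nth: "p < length xs \<Longrightarrow> insert (xs ! p) (set (drop_nth p xs)) = set xs"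
  unfolding drop_nth_def
  by (metis id_take_nth_drop Un_insert_right list.simps(15) set_append)

text \<open>If \<open>rs ! p \<bullet> g = 0\<close> then the pivot is \<open>0\<close> and \<open>eliminate\<close> merely drops row \<open>p\<close>.\<close>

definition pivot :: "nat \<Rightarrow> 'a::real_inner \<Rightarrow> 'a list \<Rightarrow> 'a" where
  "pivot p g rs = (1 / (rs ! p \<bullet> g)) *\<^sub>R (rs ! p)"

text \<open>For \<open>rs ! p \<bullet> g \<noteq> 0\<close> this is the linear projection onto the
  orthogonal complement of \<open>g\<close> along the pivot. It sends row \<open>p\<close> to 0, so
  dropping that row loses nothing of the image.\<close>

definition eliminate :: "nat \<Rightarrow> 'a::real_inner \<Rightarrow> 'a list \<Rightarrow> 'a list" where
  "eliminate p g rs = map (\<lambda>r. r - (r \<bullet> g) *\<^sub>R pivot p g rs) (drop_nth p rs)"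

lemma span_perp: "x \<in> span S \<Longrightarrow> (\<And>r. r \<in> S \<Longrightarrow> r \<bullet> h = 0) \<Longrightarrow> (x::'a::real_inner) \<bullet> h = 0"
  by (induction rule: span_induct) (auto simp: subspace_def inner_add_left)

text \<open>By linearity it suffices to look at the rows, of which only row \<open>p\<close> has no
  image in the list, and its image is 0. Vectors orthogonal to \<open>g\<close> are fixed by the
  projection, so a point of the old span that lies on the wall lies in the new span.\<close>

lemma span_eliminate:
  assumes p: "p < length rs" and g: "rs ! p \<bullet> g \<noteq> 0" and x: "x \<in> span (set rs)"
  shows "x - (x \<bullet> g) *\<^sub>R pivot p g rs \<in> span (set (eliminate p g rs))"
  using x
proof (induction rule: span_induct)
  case base
  show ?case
  proof (rule subspaceI)
    fix x y assume *: "x \<in> {x. x - (x \<bullet> g) *\<^sub>R pivot p g rs \<in> span (set (eliminate p g rs))}"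
      "y \<in> {x. x - (x \<bullet> g) *\<^sub>R pivot p g rs \<in> span (set (eliminate p g rs))}"
    have "(x + y) - ((x+y) \<bullet> g) *\<^sub>R pivot p g rs
       = (x - (x \<bullet> g) *\<^sub>R pivot p g rs) + (y - (y \<bullet> g) *\<^sub>R pivot p g rs)"
      by (simp add: algebra_simps)
    with * show "x + y \<in> {x. x - (x \<bullet> g) *\<^sub>R pivot p g rs \<in> span (set (eliminate p g rs))}"
      by (simp only: mem_Collect_eq span_add)
  next
    fix c x assume *: "x \<in> {x. x - (x \<bullet> g) *\<^sub>R pivot p g rs \<in> span (set (eliminate p g rs))}"
    have "c *\<^sub>R x - ((c *\<^sub>R x) \<bullet> g) *\<^sub>R pivot p g rs = c *\<^sub>R (x - (x \<bullet> g) *\<^sub>R pivot p g rs)"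
      by (simp add: algebra_simps)
    with * show "c *\<^sub>R x \<in> {x. x - (x \<bullet> g) *\<^sub>R pivot p g rs \<in> span (set (eliminate p g rs))}"
      by (simp only: mem_Collect_eq span_scale)
  qed (simp add: span_zero)
next
  case (step x)
  show ?case
  proof (cases "x = rs ! p")
    case True
    then have "x - (x \<bullet> g) *\<^sub>R pivot p g rs = 0" using g by (simp add: pivot_def)
    then show ?thesis by (simp add: span_zero)
  next
    case False
    then have "x \<in> set (drop_nth p rs)" using step set_drop_nth[OF p] by auto
    then show ?thesis unfolding eliminate_def by (auto intro: span_base)
  qed
qed

text \<open>A generic line through \<open>m\<close> inside the span of the face is followed to the
  wall nearest on either side; the point \<open>m'\<close> where it meets that wall serves the next
  face. Normals positive at \<open>m\<close> stay nonnegative at \<open>m'\<close>. Those that drop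
  to 0 are, on this span, positive multiples of \<open>g\<close>, so the pivot, which has value 1 at
  \<open>g\<close>, is positive on them. Closure of \<open>D\<close> under negation lets
  \<open>g\<close> be oriented, and \<open>0 \<in> D\<close> supplies the dummy choice when no
  normal cuts the face.\<close>

lemma chamber_inv_step:
  fixes D :: "'a::euclidean_space set"
  assumes fin: "finite D" and D0: "0 \<in> D" and Dsym: "\<And>h. h \<in> D \<Longrightarrow> - h \<in> D"
    and inv: "chamber_inv D l rs ks" and rs: "rs \<noteq> []"
  shows "\<exists>p<length rs. \<exists>g\<in>D. chamber_inv D l (eliminate p g rs) (pivot p g rs # ks)"
proof -
  let ?U = "span (set rs)"
  from inv obtain m where m: "m \<in> ?U"
    and gen: "\<And>h. h \<in> D \<Longrightarrow> m \<bullet> h = 0 \<Longrightarrow> \<forall>r\<in>set rs. r \<bullet> h = 0"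
    and pos: "\<And>h. h \<in> D \<Longrightarrow> l \<bullet> h > 0 \<Longrightarrow> m \<bullet> h > 0 \<or> m \<bullet> h = 0 \<and> lexpos ks h"
    unfolding chamber_inv_def by blast
  show ?thesis
  proof (cases "\<forall>h\<in>D. m \<bullet> h = 0")
    case True
    \<comment> \<open>All normals are orthogonal to the current face, so the rest of the flag is arbitrary.\<close>
    have "chamber_inv D l (eliminate 0 0 rs) (pivot 0 0 rs # ks)"
      unfolding chamber_inv_def
    proof (intro bexI[of _ 0] conjI ballI impI)
      fix h r assume "h \<in> D" "0 \<bullet> h = 0" "r \<in> set (eliminate 0 0 rs)"
      then show "r \<bullet> h = 0"
        using gen[of h] True set_drop_nth[of 0 rs] rs
        by (auto simp: eliminate_def pivot_def)
    qed (use pos True in \<open>auto simp: pivot_def span_zero\<close>)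
    then show ?thesis using D0 rs by blast
  next
    case False
    define D1 where "D1 = {h\<in>D. m \<bullet> h \<noteq> 0}"
    \<comment> \<open>The part \<open>D1\<close> makes the line meet every wall that does not
      contain the face. The other members compare meeting times:
      \<open>(m \<bullet> h) *\<^sub>R g - (m \<bullet> g) *\<^sub>R h\<close> vanishes at
      \<open>v\<close> iff the walls of \<open>g\<close> and \<open>h\<close> are met
      together.\<close>
    define F where "F = D1 \<union> {f \<in> (\<lambda>(g,h). (m \<bullet> h) *\<^sub>R g - (m \<bullet> g) *\<^sub>R h) ` (D1 \<times> D1). \<exists>u\<in>?U. u \<bullet> f \<noteq> 0}"
    have "finite D1" using fin by (simp add: D1_def)
    then have "finite F" unfolding F_def by simp
    moreover have "\<forall>f\<in>F. \<exists>u\<in>?U. u \<bullet> f \<noteq> 0" using m by (auto simp: F_def D1_def)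
    ultimately obtain v where v: "v \<in> ?U" "\<forall>f\<in>F. v \<bullet> f \<noteq> 0"
      using generic_perturb[of F "{}" ?U 0] by (auto simp: subspace_span span_zero)
    have "D1 \<noteq> {}" using False by (auto simp: D1_def)
    \<comment> \<open>The line \<open>m + t v\<close> meets \<open>h\<close> at \<open>t = - (m \<bullet> h) / (v \<bullet> h)\<close>; the nearest wall is taken. By the choice
      of \<open>F\<close>, two walls are met at the same time only if they agree on \<open>span (set rs)\<close>.\<close>
    define g0 where "g0 = arg_min_on (\<lambda>h. \<bar>m \<bullet> h\<bar> / \<bar>v \<bullet> h\<bar>) D1"
    have g0: "g0 \<in> D1" "\<forall>h\<in>D1. \<bar>m \<bullet> g0\<bar> / \<bar>v \<bullet> g0\<bar> \<le> \<bar>m \<bullet> h\<bar> / \<bar>v \<bullet> h\<bar>"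
      using arg_min_if_finite[OF \<open>finite D1\<close> \<open>D1 \<noteq> {}\<close>, of "\<lambda>h. \<bar>m \<bullet> h\<bar> / \<bar>v \<bullet> h\<bar>"]
      unfolding g0_def by (auto simp: not_less)
    \<comment> \<open>Both signs describe the same wall; this one puts \<open>m\<close> on its
      positive side.\<close>
    define g where "g = (if m \<bullet> g0 > 0 then g0 else - g0)"
    have gD: "g \<in> D" using g0 Dsym by (auto simp: g_def D1_def)
    have mg: "m \<bullet> g > 0" using g0 by (auto simp: g_def D1_def)
    have gmin: "\<bar>m \<bullet> g\<bar> / \<bar>v \<bullet> g\<bar> \<le> \<bar>m \<bullet> h\<bar> / \<bar>v \<bullet> h\<bar>" if "h \<in> D1" for h
      using g0 that by (auto simp: g_def)
    have vD: "v \<bullet> h \<noteq> 0" if "h \<in> D1" for h using v that by (auto simp: F_def)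
    have gD1: "g \<in> D1" using gD mg by (auto simp: D1_def)
    note vg = vD[OF gD1]
    define m' where "m' = m - (m \<bullet> g / (v \<bullet> g)) *\<^sub>R v"
    have m'g: "m' \<bullet> g = 0" using vg by (simp add: m'_def inner_diff_left)
    have m'U: "m' \<in> ?U" using m v by (simp add: m'_def span_diff span_scale)
    \<comment> \<open>Meeting both walls at once makes the combination vanish at \<open>v\<close>.
      Were it nonzero somewhere on the span, it would belong to \<open>F\<close>, and
      \<open>v\<close> would avoid it.\<close>
    have par: "u \<bullet> ((m \<bullet> h) *\<^sub>R g - (m \<bullet> g) *\<^sub>R h) = 0" if "h \<in> D1" "m' \<bullet> h = 0" "u \<in> ?U" for h u
    proof -
      have "v \<bullet> ((m \<bullet> h) *\<^sub>R g - (m \<bullet> g) *\<^sub>R h) = 0"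
        using that(2) vg by (simp add: m'_def inner_diff_left inner_diff_right field_simps)
      then show ?thesis using v that gD1 unfolding F_def by force
    qed
    \<comment> \<open>No wall is nearer than that of \<open>g\<close>, so the move changes the value
      at \<open>h\<close> by at most \<open>m \<bullet> h\<close>.\<close>
    have keep: "m' \<bullet> h > 0 \<or> m' \<bullet> h = 0" if "h \<in> D1" "m \<bullet> h > 0" for h
    proof -
      have "\<bar>m \<bullet> g / (v \<bullet> g) * (v \<bullet> h)\<bar> \<le> \<bar>m \<bullet> h\<bar>"
        using gmin[OF that(1)] vD[OF that(1)] by (simp add: abs_mult field_simps)
      then have "m \<bullet> g / (v \<bullet> g) * (v \<bullet> h) \<le> m \<bullet> h" using that(2) by linarith
      then show ?thesis using that(2) by (auto simp: m'_def inner_diff_left)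
    qed
    have "\<not> (\<forall>r\<in>set rs. r \<bullet> g = 0)" using span_perp[OF m, of g] mg by auto
    then obtain p where p: "p < length rs" "rs ! p \<bullet> g \<noteq> 0" by (auto simp: in_set_conv_nth)
    let ?T = "pivot p g rs"
    have Tg: "?T \<bullet> g = 1" using p by (simp add: pivot_def)
    have TU: "?T \<in> ?U" using p by (simp add: pivot_def span_base span_scale)
    have sub: "set (drop_nth p rs) \<subseteq> set rs" using set_drop_nth[OF p(1)] by auto
    have EU: "r \<in> ?U" "r \<bullet> g = 0" if "r \<in> set (eliminate p g rs)" for r
      using that sub TU Tg by (auto simp: eliminate_def span_diff span_scale span_base inner_diff_left)
    \<comment> \<open>Walls outside \<open>D1\<close> contain the whole face: \<open>m'\<close> and
      the pivot are 0 on their normals, and the decision stays with \<open>ks\<close>.\<close>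
    have perpU: "u \<bullet> h = 0" if "h \<in> D" "h \<notin> D1" "u \<in> ?U" for h u
      using span_perp[OF that(3)] gen that by (auto simp: D1_def)
    have "chamber_inv D l (eliminate p g rs) (?T # ks)"
      unfolding chamber_inv_def
    proof (intro bexI[of _ m'] conjI ballI impI)
      show "m' \<in> span (set (eliminate p g rs))"
        using span_eliminate[OF p m'U] m'g by simp
    next
      fix h r assume h: "h \<in> D" "m' \<bullet> h = 0" and r: "r \<in> set (eliminate p g rs)"
      show "r \<bullet> h = 0"
      proof (cases "h \<in> D1")
        case True
        then show ?thesis using par[OF True h(2) EU(1)[OF r]] EU(2)[OF r] mg
          by (simp add: inner_diff_right)
      qed (use perpU h EU[OF r] in auto)
    next
      fix h assume h: "h \<in> D" "l \<bullet> h > 0"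
      show "m' \<bullet> h > 0 \<or> m' \<bullet> h = 0 \<and> lexpos (?T # ks) h"
      proof (cases "h \<in> D1")
        case True
        then have mh: "m \<bullet> h > 0" using pos[OF h] by (auto simp: D1_def)
        show ?thesis
        proof (cases "m' \<bullet> h = 0")
          case z: True
          have "m \<bullet> h = (m \<bullet> g) * (?T \<bullet> h)"
            using par[OF True z TU] Tg by (simp add: inner_diff_right)
          then have "?T \<bullet> h > 0" using mh mg by (metis zero_less_mult_pos)
          with z show ?thesis by simp
        qed (use keep[OF True mh] in auto)
      next
        case False
        then show ?thesis using perpU[OF h(1) False] pos[OF h] TU m'U h by (auto simp: D1_def)
      qed
    qed
    then show ?thesis using p gD by blast
  qed
qed

text \<open>The point \<open>m\<close> is a multiple \<open>a\<close> of \<open>r\<close>. If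
  \<open>a \<noteq> 0\<close>, its sign is the one sought; if \<open>a = 0\<close>, genericity of
  \<open>m\<close> makes \<open>r\<close> vanish on all of \<open>D\<close>, and either sign will
  do.\<close>

lemma chamber_inv_single:
  assumes "chamber_inv D l [r] ks"
  shows "\<exists>\<sigma>\<in>{1,-1::real}. \<forall>h\<in>D. l \<bullet> h > 0 \<longrightarrow> lexpos (\<sigma> *\<^sub>R r # ks) h"
proof -
  from assms obtain a where a: "\<And>h. h \<in> D \<Longrightarrow> a * (r \<bullet> h) = 0 \<Longrightarrow> r \<bullet> h = 0"
    and pos: "\<And>h. h \<in> D \<Longrightarrow> l \<bullet> h > 0 \<Longrightarrow> a * (r \<bullet> h) > 0 \<or> a * (r \<bullet> h) = 0 \<and> lexpos ks h"
    unfolding chamber_inv_def by (auto simp: span_singleton)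
  show ?thesis
    by (rule bexI[of _ "if a > 0 then 1 else -1"])
      (use a pos in \<open>fastforce simp: zero_less_mult_iff\<close>)+
qed

section \<open>The greedy algorithm\<close>

lemma matroid_finite:
  assumes "matroid N \<B>"
  shows "finite \<B>" "B \<in> \<B> \<Longrightarrow> finite B" "B \<in> \<B> \<Longrightarrow> B \<subseteq> N"
  using assms unfolding matroid_def by (metis finite_Pow_iff finite_subset, metis PowD finite_subset subsetD, auto)

lemma matroid_exchange:
  assumes "matroid N \<B>" "A \<in> \<B>" "B \<in> \<B>" "a \<in> A - B"
  obtains b where "b \<in> B - A" "insert b (A - {a}) \<in> \<B>"
  using assms unfolding matroid_def by meson

text \<open>Exchanging the elements of \<open>A - B\<close> one by one leads to a basis inside
  \<open>B\<close> without changing the size; a basis properly inside \<open>B\<close> would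
  contradict the exchange property read from \<open>B\<close>.\<close>

lemma matroid_card_eq:
  assumes M: "matroid N \<B>" and "A \<in> \<B>" "B \<in> \<B>"
  shows "card A = card B"
  using assms(2)
proof (induction "card (A - B)" arbitrary: A rule: less_induct)
  case less
  have finA: "finite A" using matroid_finite[OF M] less by auto
  show ?case
  proof (cases "A \<subseteq> B")
    case True
    have "b \<in> A" if "b \<in> B" for b
      using matroid_exchange[OF M assms(3) less.prems, of b] that True by blast
    then show ?thesis using True by (metis subsetI subset_antisym)
  next
    case False
    then obtain a where a: "a \<in> A - B" by auto
    then obtain b where b: "b \<in> B - A" "insert b (A - {a}) \<in> \<B>"
      using matroid_exchange[OF M less.prems assms(3)] by metis
    have "insert b (A - {a}) - B = (A - B) - {a}" using a b by auto
    then have "card (insert b (A - {a}) - B) < card (A - B)"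
      using a finA by (metis card_Diff1_less finite_Diff)
    then have "card (insert b (A - {a})) = card B" using less.hyps b by blast
    moreover have "card (insert b (A - {a})) = card A"
    proof -
      have "card (insert b (A - {a})) = Suc (card (A - {a}))" using b finA by simp
      then show ?thesis using a finA card.remove[of A a] by simp
    qed
    ultimately show ?thesis by simp
  qed
qed

text \<open>A basis containing \<open>insert x J\<close> is pushed into \<open>insert x B\<close> by
  exchanges against \<open>B\<close>, which never remove \<open>x\<close> or elements of
  \<open>J\<close>. Having the size of \<open>B\<close>, the result omits exactly one element of
  \<open>insert x B\<close>, and that element is the \<open>b\<close> sought.\<close>

lemma matroid_augment:
  assumes M: "matroid N \<B>" and B: "B \<in> \<B>" "J \<subseteq> B" "x \<notin> B" and ind: "indep \<B> (insert x J)"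
  shows "\<exists>b\<in>B - J. insert x (B - {b}) \<in> \<B>"
proof -
  from ind obtain C where C: "C \<in> \<B>" "insert x J \<subseteq> C" unfolding indep_def by auto
  have "\<exists>A\<in>\<B>. insert x J \<subseteq> A \<and> A \<subseteq> insert x B"
    using C
  proof (induction "card (C - insert x B)" arbitrary: C rule: less_induct)
    case less
    show ?case
    proof (cases "C \<subseteq> insert x B")
      case False
      then obtain a where a: "a \<in> C - insert x B" by auto
      then obtain b where b: "b \<in> B - C" "insert b (C - {a}) \<in> \<B>"
        using matroid_exchange[OF M less.prems(1) B(1), of a] by blast
      have "insert b (C - {a}) - insert x B = (C - insert x B) - {a}" using a b by auto
      then have "card (insert b (C - {a}) - insert x B) < card (C - insert x B)"
        using a matroid_finite(2)[OF M less.prems(1)] by (metis card_Diff1_less finite_Diff)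
      moreover have "insert x J \<subseteq> insert b (C - {a})" using less.prems a B by auto
      ultimately show ?thesis using less.hyps b by blast
    qed (use less in blast)
  qed
  then obtain A where A: "A \<in> \<B>" "insert x J \<subseteq> A" "A \<subseteq> insert x B" by auto
  have fB: "finite B" using matroid_finite[OF M] B by auto
  have cA: "card A = card B" using matroid_card_eq[OF M A(1) B(1)] .
  have "card (insert x B) = Suc (card A)" using cA B fB by simp
  then have "card (insert x B - A) = 1"
    using A(3) fB card_Diff_subset[of A "insert x B"] finite_subset[of A "insert x B"] by (simp del: card_insert_if)
  then obtain b where b: "insert x B - A = {b}" by (auto simp: card_1_singleton_iff)
  then have "A = insert x (B - {b})" "b \<in> B - J" using A B by auto
  then show ?thesis using A by auto
qed

section \<open>Optimality of the greedy choice\<close>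

definition greedy_add :: "nat set set \<Rightarrow> nat \<Rightarrow> nat set \<Rightarrow> nat set" where
  "greedy_add \<B> x J = (if indep \<B> (insert x J) then insert x J else J)"

text \<open>The greedy set is kept equal to the trace of some optimal basis on the processed prefix.
  If greedy accepts an \<open>x\<close> missing from that basis, \<open>x\<close> is swapped in for
  some \<open>b\<close> outside the prefix; such a \<open>b\<close> weighs at most as much as
  \<open>x\<close>, so optimality survives.\<close>

lemma greedy_prefix:
  fixes f :: "nat \<Rightarrow> real"
  assumes M: "matroid N \<B>"
  assumes "distinct xs" "set xs \<subseteq> N" "sorted_wrt (\<lambda>x y. f y \<le> f x) xs"
    "\<forall>x\<in>set xs. \<forall>y\<in>N - set xs. f y \<le> f x"
  shows "\<exists>B\<in>\<B>. (\<forall>A\<in>\<B>. sum f A \<le> sum f B) \<and> B \<inter> set xs = fold (greedy_add \<B>) xs {}"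
  using assms(2-)
proof (induction xs rule: rev_induct)
  case Nil
  have "\<B> \<noteq> {}" "finite \<B>" using M matroid_finite by (auto simp: matroid_def)
  then obtain B where "B \<in> \<B>" "\<forall>A\<in>\<B>. sum f A \<le> sum f B"
    using finite_has_maximizer[of \<B> "sum f"] by metis
  then show ?case by auto
next
  case (snoc x xs)
  let ?J = "fold (greedy_add \<B>) xs {}"
  have "\<forall>z\<in>set xs. \<forall>y\<in>N - set xs. f y \<le> f z"
  proof (intro ballI)
    fix z y assume "z \<in> set xs" "y \<in> N - set xs"
    then show "f y \<le> f z" using snoc.prems by (cases "y = x") (auto simp: sorted_wrt_append)
  qed
  with snoc obtain B where B: "B \<in> \<B>" "\<And>A. A \<in> \<B> \<Longrightarrow> sum f A \<le> sum f B" "B \<inter> set xs = ?J"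
    by (auto simp: sorted_wrt_append)
  have fB: "finite B" "B \<subseteq> N" using matroid_finite[OF M] B by auto
  have xn: "x \<notin> set xs" using snoc.prems by auto
  have Jx: "fold (greedy_add \<B>) (xs @ [x]) {} = (if indep \<B> (insert x ?J) then insert x ?J else ?J)"
    by (simp add: greedy_add_def[of \<B> x ?J])
  show ?case
  proof (cases "indep \<B> (insert x ?J)")
    case False
    then have "x \<notin> B" using B by (auto simp: indep_def)
    then show ?thesis using False B by (intro bexI[of _ B]) (auto simp: Jx simp del: fold_append)
  next
    case True
    show ?thesis
    proof (cases "x \<in> B")
      case xB: True
      then show ?thesis using True B by (intro bexI[of _ B]) (auto simp: Jx simp del: fold_append)
    next
      case xB: False
      have "?J \<subseteq> B" using B by auto
      then obtain b where b: "b \<in> B - ?J" "insert x (B - {b}) \<in> \<B>"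
        using matroid_augment[OF M B(1) _ xB True] by auto
      \<comment> \<open>The trace of \<open>B\<close> on the prefix is \<open>?J\<close>, and
        \<open>b\<close> avoids \<open>?J\<close>; hence \<open>b\<close> is still to come.\<close>
      have bn: "b \<notin> set xs" "b \<noteq> x" using b B xB by auto
      then have "f b \<le> f x" using snoc.prems(4) b fB by auto
      moreover have "sum f (insert x (B - {b})) = f x + sum f B - f b"
        using fB b xB by (simp add: sum_diff1)
      ultimately have "\<And>A. A \<in> \<B> \<Longrightarrow> sum f A \<le> sum f (insert x (B - {b}))"
        using B(2) by fastforce
      moreover have "insert x (B - {b}) \<inter> set (xs @ [x]) = insert x ?J"
        using B(3) bn xn by auto
      ultimately show ?thesis using True b
        by (intro bexI[of _ "insert x (B - {b})"]) (auto simp: Jx simp del: fold_append)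
    qed
  qed
qed

text \<open>When the prefix is all of \<open>N\<close>, the trace is the basis itself. A constant
  \<open>f\<close> admits every order, so the first claim also covers orders that come from no
  functional.\<close>

lemma greedy_optimal:
  fixes f :: "nat \<Rightarrow> real"
  assumes "matroid N \<B>" "distinct xs" "set xs = N" "sorted_wrt (\<lambda>x y. f y \<le> f x) xs"
  shows "fold (greedy_add \<B>) xs {} \<in> \<B>"
    and "A \<in> \<B> \<Longrightarrow> sum f A \<le> sum f (fold (greedy_add \<B>) xs {})"
proof -
  obtain B where B: "B \<in> \<B>" "\<forall>A\<in>\<B>. sum f A \<le> sum f B" "B \<inter> set xs = fold (greedy_add \<B>) xs {}"
    using greedy_prefix[OF assms(1,2) _ assms(4)] assms(3) by auto
  moreover have "B \<subseteq> N" using matroid_finite[OF assms(1)] B by auto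
  ultimately have "fold (greedy_add \<B>) xs {} = B" using assms(3) by auto
  with B show "fold (greedy_add \<B>) xs {} \<in> \<B>" "A \<in> \<B> \<Longrightarrow> sum f A \<le> sum f (fold (greedy_add \<B>) xs {})"
    by auto
qed

section \<open>Bounded executions\<close>

text \<open>Total correctness with the two counters as budgets. Being monotone in both, it lets
  bounds be rounded up at any point.\<close>

definition wp :: "(nat set \<Rightarrow> bool) \<Rightarrow> ((nat \<Rightarrow> real) \<Rightarrow> real) \<Rightarrow> com \<Rightarrow> mem \<Rightarrow> nat \<Rightarrow> nat \<Rightarrow> (mem \<Rightarrow> bool) \<Rightarrow> bool" where
  "wp ind ev P s q t R \<longleftrightarrow> (\<exists>q' t' s'. run ind ev P s q' t' s' \<and> q' \<le> q \<and> t' \<le> t \<and> R s')"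

inductive_cases run_SkipE: "run ind ev SKIP s q t s'"
inductive_cases run_ISetE: "run ind ev (ISet x e) s q t s'"
inductive_cases run_IPutE: "run ind ev (IPut a e f) s q t s'"
inductive_cases run_RPutE: "run ind ev (RPut a e f) s q t s'"
inductive_cases run_IndepE: "run ind ev (INDEP x a) s q t s'"
inductive_cases run_EvalE: "run ind ev (EVAL a e b) s q t s'"
inductive_cases run_SeqE: "run ind ev (SEQ P Q) s q t s'"
inductive_cases run_CondE: "run ind ev (COND b P Q) s q t s'"

lemma wp_SKIP [simp]: "wp ind ev SKIP s q t R \<longleftrightarrow> 1 \<le> t \<and> R s"
  unfolding wp_def by (fastforce intro: run.Skip elim: run_SkipE)

lemma wp_ISet [simp]: "wp ind ev (ISet x e) s q t R \<longleftrightarrow> 1 \<le> t \<and> R (put_ivar x (ival e s) s)"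
  unfolding wp_def by (fastforce intro: run.ISet elim: run_ISetE)

lemma wp_IPut [simp]: "wp ind ev (IPut a e f) s q t R \<longleftrightarrow> 1 \<le> t \<and> R (put_iarr a (ival e s) (ival f s) s)"
  unfolding wp_def by (fastforce intro: run.IPut elim: run_IPutE)

lemma wp_RPut [simp]:
  "wp ind ev (RPut a e f) s q t R \<longleftrightarrow> rcost f \<le> q \<and> 1 \<le> t \<and> R (put_rarr a (ival e s) (rval f s) s)"
  unfolding wp_def by (fastforce intro: run.RPut elim: run_RPutE)

lemma wp_INDEP [simp]:
  "wp ind ev (INDEP x a) s q t R \<longleftrightarrow>
     1 \<le> q \<and> 1 \<le> t \<and> R (put_ivar x (if ind (iarr_set a s) then 1 else 0) s)"
  unfolding wp_def by (fastforce intro: run.Indep elim: run_IndepE)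

lemma wp_EVAL [simp]:
  "wp ind ev (EVAL a e b) s q t R \<longleftrightarrow> 1 \<le> q \<and> 1 \<le> t \<and> R (put_rarr a (ival e s) (ev (rarr s b)) s)"
  unfolding wp_def by (fastforce intro: run.Eval elim: run_EvalE)

lemma wp_COND [simp]:
  "wp ind ev (COND b P Q) s q t R \<longleftrightarrow> bcost b \<le> q \<and> 1 \<le> t \<and>
     (if bval b s then wp ind ev P s (q - bcost b) (t - 1) R else wp ind ev Q s (q - bcost b) (t - 1) R)"
  (is "?L \<longleftrightarrow> ?R")
proof
  assume ?L
  then obtain q' t' s' where *: "run ind ev (COND b P Q) s q' t' s'" "q' \<le> q" "t' \<le> t" "R s'"
    unfolding wp_def by blast
  from *(1) show ?R
    by (cases rule: run_CondE) (use *(2-) in \<open>force simp: wp_def\<close>)+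
next
  assume R: ?R
  show ?L
  proof (cases "bval b s")
    case True
    with R obtain q' t' s' where *: "run ind ev P s q' t' s'" "q' \<le> q - bcost b" "t' \<le> t - 1" "R s'"
      unfolding wp_def by auto
    from run.CondTrue[OF True *(1)] show ?thesis unfolding wp_def using * R
      by (intro exI[of _ "bcost b + q'"] exI[of _ "1 + t'"] exI[of _ s']) auto
  next
    case False
    with R obtain q' t' s' where *: "run ind ev Q s q' t' s'" "q' \<le> q - bcost b" "t' \<le> t - 1" "R s'"
      unfolding wp_def by auto
    from run.CondFalse[OF False *(1)] show ?thesis unfolding wp_def using * R
      by (intro exI[of _ "bcost b + q'"] exI[of _ "1 + t'"] exI[of _ s']) auto
  qed
qed

lemma wp_SEQ:
  assumes "wp ind ev P s q t Q" and "\<And>s'. Q s' \<Longrightarrow> wp ind ev P' s' q' t' R"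
    and "q + q' \<le> q''" "t + t' \<le> t''"
  shows "wp ind ev (SEQ P P') s q'' t'' R"
proof -
  from assms(1) obtain a b s' where 1: "run ind ev P s a b s'" "a \<le> q" "b \<le> t" "Q s'"
    unfolding wp_def by blast
  from assms(2)[OF 1(4)] obtain a' b' s'' where 2: "run ind ev P' s' a' b' s''" "a' \<le> q'" "b' \<le> t'" "R s''"
    unfolding wp_def by blast
  from run.Seq[OF 1(1) 2(1)] show ?thesis unfolding wp_def using 1 2 assms(3,4)
    by (intro exI[of _ "a + a'"] exI[of _ "b + b'"] exI[of _ s'']) auto
qed

lemma wp_SEQ_iff:
  "wp ind ev (SEQ P Q) s q t R \<longleftrightarrow> (\<exists>q1 t1. q1 \<le> q \<and> t1 \<le> t \<and>
     wp ind ev P s q1 t1 (\<lambda>s'. wp ind ev Q s' (q - q1) (t - t1) R))"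
proof
  assume "wp ind ev (SEQ P Q) s q t R"
  then obtain q' t' s' where *: "run ind ev (SEQ P Q) s q' t' s'" "q' \<le> q" "t' \<le> t" "R s'"
    unfolding wp_def by blast
  then obtain q1 t1 u q2 t2 where "run ind ev P s q1 t1 u" "run ind ev Q u q2 t2 s'"
      "q' = q1 + q2" "t' = t1 + t2"
    by (elim run_SeqE) simp
  with * show "\<exists>q1 t1. q1 \<le> q \<and> t1 \<le> t \<and> wp ind ev P s q1 t1 (\<lambda>s'. wp ind ev Q s' (q - q1) (t - t1) R)"
    unfolding wp_def by (intro exI[of _ q1] exI[of _ t1]) force
next
  assume "\<exists>q1 t1. q1 \<le> q \<and> t1 \<le> t \<and> wp ind ev P s q1 t1 (\<lambda>s'. wp ind ev Q s' (q - q1) (t - t1) R)"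
  then show "wp ind ev (SEQ P Q) s q t R" by (auto elim!: wp_SEQ)
qed

lemma wp_mono:
  "wp ind ev P s q t Q \<Longrightarrow> q \<le> q' \<Longrightarrow> t \<le> t' \<Longrightarrow> (\<And>s'. Q s' \<Longrightarrow> R s') \<Longrightarrow> wp ind ev P s q' t' R"
  unfolding wp_def by (meson order_trans)

text \<open>After an atomic command the split of the budget is forced, so straight-line code can be
  executed symbolically by simplification; only compound parts need an explicit split.\<close>

lemma wp_SEQ_atom:
  assumes "\<And>q t R. wp ind ev P s q t R \<longleftrightarrow> k \<le> q \<and> 1 \<le> t \<and> R s'"
  shows "wp ind ev (SEQ P Q) s q t R \<longleftrightarrow> k \<le> q \<and> 1 \<le> t \<and> wp ind ev Q s' (q - k) (t - 1) R"
proof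
  assume "wp ind ev (SEQ P Q) s q t R"
  then obtain q1 t1 where "q1 \<le> q" "t1 \<le> t" "k \<le> q1" "1 \<le> t1" "wp ind ev Q s' (q - q1) (t - t1) R"
    unfolding wp_SEQ_iff assms by blast
  then show "k \<le> q \<and> 1 \<le> t \<and> wp ind ev Q s' (q - k) (t - 1) R" by (auto elim!: wp_mono)
next
  assume "k \<le> q \<and> 1 \<le> t \<and> wp ind ev Q s' (q - k) (t - 1) R"
  then show "wp ind ev (SEQ P Q) s q t R" unfolding wp_SEQ_iff assms by blast
qed

lemma wp_SEQ_ISet [simp]:
  "wp ind ev (SEQ (ISet x e) Q) s q t R \<longleftrightarrow> 1 \<le> t \<and> wp ind ev Q (put_ivar x (ival e s) s) q (t - 1) R"
  by (subst wp_SEQ_atom[where k = 0 and s' = "put_ivar x (ival e s) s"]) simp_all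

lemma wp_SEQ_IPut [simp]:
  "wp ind ev (SEQ (IPut a e f) Q) s q t R \<longleftrightarrow>
     1 \<le> t \<and> wp ind ev Q (put_iarr a (ival e s) (ival f s) s) q (t - 1) R"
  by (subst wp_SEQ_atom[where k = 0 and s' = "put_iarr a (ival e s) (ival f s) s"]) simp_all

lemma wp_SEQ_RPut [simp]:
  "wp ind ev (SEQ (RPut a e f) Q) s q t R \<longleftrightarrow>
     rcost f \<le> q \<and> 1 \<le> t \<and> wp ind ev Q (put_rarr a (ival e s) (rval f s) s) (q - rcost f) (t - 1) R"
  by (rule wp_SEQ_atom) (rule wp_RPut)

lemma wp_SEQ_INDEP [simp]:
  "wp ind ev (SEQ (INDEP x a) Q) s q t R \<longleftrightarrow> 1 \<le> q \<and> 1 \<le> t \<and>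
     wp ind ev Q (put_ivar x (if ind (iarr_set a s) then 1 else 0) s) (q - 1) (t - 1) R"
  by (rule wp_SEQ_atom) (rule wp_INDEP)

lemma wp_SEQ_EVAL [simp]:
  "wp ind ev (SEQ (EVAL a e b) Q) s q t R \<longleftrightarrow> 1 \<le> q \<and> 1 \<le> t \<and>
     wp ind ev Q (put_rarr a (ival e s) (ev (rarr s b)) s) (q - 1) (t - 1) R"
  by (rule wp_SEQ_atom) (rule wp_EVAL)

section \<open>Loops and unrolled sequences\<close>

lemma put_sel [simp]:
  "ivar (put_ivar x v s) = (ivar s)(x := v)"
  "iarr (put_ivar x v s) = iarr s"
  "rarr (put_ivar x v s) = rarr s"
  "ivar (put_iarr a i v s) = ivar s"
  "iarr (put_iarr a i v s) = (iarr s)(a := (iarr s a)(i := v))"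
  "rarr (put_iarr a i v s) = rarr s"
  "ivar (put_rarr a i r s) = ivar s"
  "iarr (put_rarr a i r s) = iarr s"
  "rarr (put_rarr a i r s) = (rarr s)(a := (rarr s a)(i := r))"
  by (auto simp: put_ivar_def put_iarr_def put_rarr_def)

text \<open>In \<open>I k\<close>, the number \<open>k\<close> bounds the number of iterations still to come.\<close>

lemma wp_WHILE:
  assumes "I k s"
    and step: "\<And>k s. I k s \<Longrightarrow> bval b s \<Longrightarrow> \<exists>k'. k = Suc k' \<and> wp ind ev P s q t (I k')"
    and fin: "\<And>k s. I k s \<Longrightarrow> \<not> bval b s \<Longrightarrow> R s"
    and "bcost b = 0" "k * q \<le> q'" "1 + k * (1 + t) \<le> t'"
  shows "wp ind ev (WHILE b P) s q' t' R"
proof -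
  have "wp ind ev (WHILE b P) s (k * q) (1 + k * (1 + t)) R"
    using assms(1)
  proof (induction k arbitrary: s)
    case (0 s)
    then have "\<not> bval b s" using step by blast
    from run.WhileFalse[OF this] fin[OF 0 this] show ?case
      unfolding wp_def using assms(4) by (intro exI[of _ 0] exI[of _ 1] exI[of _ s]) auto
  next
    case (Suc k s)
    show ?case
    proof (cases "bval b s")
      case True
      from step[OF Suc.prems True] obtain a c s' where
        1: "run ind ev P s a c s'" "a \<le> q" "c \<le> t" "I k s'" unfolding wp_def by auto
      from Suc.IH[OF 1(4)] obtain a' c' s'' where
        2: "run ind ev (WHILE b P) s' a' c' s''" "a' \<le> k * q" "c' \<le> 1 + k * (1 + t)" "R s''"
        unfolding wp_def by auto
      from run.WhileTrue[OF True 1(1) 2(1)] show ?thesis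
        unfolding wp_def using 1 2 assms(4)
        by (intro exI[of _ "bcost b + a + a'"] exI[of _ "1 + c + c'"] exI[of _ s'']) auto
    next
      case False
      from run.WhileFalse[OF this] fin[OF Suc.prems this] show ?thesis
        unfolding wp_def using assms(4) by (intro exI[of _ 0] exI[of _ 1] exI[of _ s]) auto
    qed
  qed
  then show ?thesis using assms(5,6) by (rule wp_mono)
qed

definition For :: "nat \<Rightarrow> com \<Rightarrow> com" where
  "For x P = SEQ (ISet x (IConst 1)) (WHILE (ILess (IVar x) (IAdd (IVar 0) (IConst 1)))
     (SEQ P (ISet x (IAdd (IVar x) (IConst 1)))))"

text \<open>\<open>I i\<close> describes the state just before pass \<open>i\<close>. Each pass pays
  for a test and an increment besides its body; the remaining 2 steps are the initial assignment and
  the failing test.\<close>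

lemma wp_For:
  assumes "x \<noteq> 0" "ivar s 0 = n" and init: "I 1 (put_ivar x 1 s)"
    and step: "\<And>i s. 1 \<le> i \<Longrightarrow> i \<le> n \<Longrightarrow> I i s \<Longrightarrow> ivar s x = i \<Longrightarrow> ivar s 0 = n \<Longrightarrow>
      wp ind ev P s q t (\<lambda>s'. ivar s' x = i \<and> ivar s' 0 = n \<and> I (Suc i) (put_ivar x (Suc i) s'))"
    and fin: "\<And>s. I (Suc n) s \<Longrightarrow> ivar s x = Suc n \<Longrightarrow> ivar s 0 = n \<Longrightarrow> R s"
    and "n * q \<le> q'" "2 + n * (t + 2) \<le> t'"
  shows "wp ind ev (For x P) s q' t' R"
proof -
  define J where "J k s \<longleftrightarrow> (\<exists>i. 1 \<le> i \<and> i + k = Suc n \<and> I i s \<and> ivar s x = i \<and> ivar s 0 = n)" for k s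
  have "wp ind ev (WHILE (ILess (IVar x) (IAdd (IVar 0) (IConst 1)))
     (SEQ P (ISet x (IAdd (IVar x) (IConst 1))))) (put_ivar x 1 s) q' (t' - 1) R"
  proof (rule wp_WHILE[where I = J and k = n and q = q and t = "t + 1"])
    show "J n (put_ivar x 1 s)" using assms(1,2) init by (auto simp: J_def)
  next
    fix k s assume "J k s" "bval (ILess (IVar x) (IAdd (IVar 0) (IConst 1))) s"
    then obtain i where i: "1 \<le> i" "i + k = Suc n" "I i s" "ivar s x = i" "ivar s 0 = n" "i \<le> n"
      by (auto simp: J_def)
    then obtain k' where k': "k = Suc k'" by (cases k) auto
    have "wp ind ev (SEQ P (ISet x (IAdd (IVar x) (IConst 1)))) s q (t + 1) (J k')"
      by (rule wp_SEQ[OF step[OF i(1,6,3,4,5)], where q' = 0 and t' = 1])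
        (use i k' assms(1) in \<open>auto simp: J_def\<close>)
    then show "\<exists>k'. k = Suc k' \<and> wp ind ev (SEQ P (ISet x (IAdd (IVar x) (IConst 1)))) s q (t + 1) (J k')"
      using k' by blast
  next
    fix k s assume "J k s" "\<not> bval (ILess (IVar x) (IAdd (IVar 0) (IConst 1))) s"
    then obtain i where "1 \<le> i" "i + k = Suc n" "I i s" "ivar s x = i" "ivar s 0 = n" "\<not> i < Suc n"
      by (auto simp: J_def)
    moreover from this have "i = Suc n" by simp
    ultimately show "R s" using fin by simp
  qed (use assms(6,7) in \<open>auto simp: algebra_simps\<close>)
  then show ?thesis unfolding For_def using assms(7) by simp
qed

lemma wp_fill:
  assumes "x \<noteq> 0" "ivar s 0 = n"
    and e: "\<And>i s'. 1 \<le> i \<Longrightarrow> i \<le> n \<Longrightarrow> ivar s' = (ivar s)(x := i) \<Longrightarrow>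
        (\<And>b. b \<noteq> a \<Longrightarrow> rarr s' b = rarr s b) \<Longrightarrow> iarr s' = iarr s \<Longrightarrow> rval e s' = F i"
    and "R (s\<lparr>ivar := (ivar s)(x := Suc n), rarr := (rarr s)(a := (\<lambda>j. if 1 \<le> j \<and> j \<le> n then F j else rarr s a j))\<rparr>)"
    and "n * rcost e \<le> q'" "2 + n * 3 \<le> t'"
  shows "wp ind ev (For x (RPut a (IVar x) e)) s q' t' R"
proof (rule wp_For[where I = "\<lambda>i s'. s' = s\<lparr>ivar := (ivar s)(x := i),
      rarr := (rarr s)(a := (\<lambda>j. if 1 \<le> j \<and> j < i then F j else rarr s a j))\<rparr>"
      and q = "rcost e" and t = 1 and n = n])
  fix i s'
  assume i: "1 \<le> i" "i \<le> n" and s': "s' = s\<lparr>ivar := (ivar s)(x := i),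
      rarr := (rarr s)(a := (\<lambda>j. if 1 \<le> j \<and> j < i then F j else rarr s a j))\<rparr>"
    and "ivar s' x = i" "ivar s' 0 = n"
  have "rval e s' = F i" using i by (intro e) (auto simp: s')
  then show "wp ind ev (RPut a (IVar x) e) s' (rcost e) 1
     (\<lambda>s'. ivar s' x = i \<and> ivar s' 0 = n \<and> put_ivar x (Suc i) s' = s\<lparr>ivar := (ivar s)(x := Suc i),
      rarr := (rarr s)(a := (\<lambda>j. if 1 \<le> j \<and> j < Suc i then F j else rarr s a j))\<rparr>)"
    using i assms(1,2) by (auto simp: s' put_ivar_def put_rarr_def fun_eq_iff less_Suc_eq)
next
  fix s' assume "s' = s\<lparr>ivar := (ivar s)(x := Suc n),
      rarr := (rarr s)(a := (\<lambda>j. if 1 \<le> j \<and> j < Suc n then F j else rarr s a j))\<rparr>"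
  then show "R s'" using assms(4) by (simp add: less_Suc_eq_le)
qed (use assms in \<open>auto simp: put_ivar_def fun_eq_iff\<close>)

text \<open>Array names are literals of the syntax, so an iteration over coordinates or rows has to
  be unrolled. The program grows with \<open>d\<close> but not with \<open>n\<close>.\<close>

primrec Seqs :: "com list \<Rightarrow> com" where
  "Seqs [] = SKIP"
| "Seqs (P # Ps) = SEQ P (Seqs Ps)"

lemma wp_Seqs:
  assumes "I 0 s" and step: "\<And>k s. k < length Ps \<Longrightarrow> I k s \<Longrightarrow> wp ind ev (Ps ! k) s q t (I (Suc k))"
    and fin: "\<And>s. I (length Ps) s \<Longrightarrow> R s"
    and "length Ps * q \<le> q'" "1 + length Ps * t \<le> t'"
  shows "wp ind ev (Seqs Ps) s q' t' R"
proof -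
  have "wp ind ev (Seqs Ps) s (length Ps * q) (1 + length Ps * t) R"
    using assms(1-3)
  proof (induction Ps arbitrary: I s)
    case (Cons P Ps)
    have "wp ind ev P s q t (I 1)" using Cons.prems(2)[of 0 s] Cons.prems(1) by simp
    moreover have "wp ind ev (Seqs Ps) s' (length Ps * q) (1 + length Ps * t) R" if "I 1 s'" for s'
      by (rule Cons.IH[of "\<lambda>k. I (Suc k)"]) (use that Cons.prems(2)[of "Suc k" for k] Cons.prems(3) in auto)
    ultimately show ?case by (auto elim!: wp_SEQ)
  qed simp
  then show ?thesis using assms(4,5) by (rule wp_mono)
qed

section \<open>Binary insertion sort\<close>

primrec key_less :: "(nat \<Rightarrow> real) list \<Rightarrow> nat \<Rightarrow> nat \<Rightarrow> bool" where
  "key_less [] x y \<longleftrightarrow> False"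
| "key_less (k # ks) x y \<longleftrightarrow> k x < k y \<or> \<not> k y < k x \<and> key_less ks x y"

lemma key_less_asym: "key_less ks x y \<Longrightarrow> \<not> key_less ks y x"
  by (induction ks) auto

text \<open>Ties make the order a strict weak one. Transitivity of the negation is what carries the
  outcome of one comparison over to a whole half of a sorted list.\<close>

lemma key_le_trans: "\<not> key_less ks x y \<Longrightarrow> \<not> key_less ks y z \<Longrightarrow> \<not> key_less ks x z"
  by (induction ks) auto

section \<open>Lexicographic comparison and binary search\<close>

text \<open>
  Index variable \<open>0\<close> holds \<open>n\<close>; the variables \<open>1, \<dots>, 8\<close> are scratch space of the sorting and greedy
  routines, \<open>9\<close> is nonzero once a basis has been stored, and the ones from \<open>10\<close> on are loop counters
  of the enumeration. Index array \<open>0\<close> is the best basis so far, \<open>1\<close> the sorted order (from cell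
  \<open>0\<close> on), \<open>2\<close> the greedy set. Real array \<open>d\<close> is the point passed to the evaluation oracle; array
  \<open>d + 1\<close> has the best value in cell \<open>0\<close> and the current value in cell \<open>1\<close>; the arrays from
  \<open>d + 2\<close> on hold the rows of the elimination.
\<close>

primrec Less :: "nat list \<Rightarrow> iexp \<Rightarrow> iexp \<Rightarrow> com" where
  "Less [] x y = ISet 5 (IConst 0)"
| "Less (k # ks) x y = COND (RLess (RGet k x) (RGet k y)) (ISet 5 (IConst 1))
     (COND (RLess (RGet k y) (RGet k x)) (ISet 5 (IConst 0)) (Less ks x y))"

lemma wp_Less:
  assumes "R (put_ivar 5 (if key_less (map (rarr s) ks) (ival x s) (ival y s) then 1 else 0) s)"
  shows "wp ind ev (Less ks x y) s (2 * length ks) (2 * length ks + 1) R"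
  using assms by (induction ks) (auto elim!: wp_mono)

text \<open>Index arithmetic has no division, so half the interval length, rounded down, is found by
  counting: linear in steps, free of real operations.\<close>

definition Half :: com where
  "Half = SEQ (ISet 4 (IConst 0)) (WHILE (ILess (IAdd (IAdd (IVar 4) (IVar 4)) (IConst 1)) (ISub (IVar 3) (IVar 2)))
     (ISet 4 (IAdd (IVar 4) (IConst 1))))"

lemma wp_Half:
  assumes "ivar s 3 - ivar s 2 \<le> n" "R (put_ivar 4 ((ivar s 3 - ivar s 2) div 2) s)" "2 + n * 2 \<le> t"
  shows "wp ind ev Half s q t R"
proof -
  let ?h = "(ivar s 3 - ivar s 2) div 2"
  have "wp ind ev (WHILE (ILess (IAdd (IAdd (IVar 4) (IVar 4)) (IConst 1)) (ISub (IVar 3) (IVar 2)))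
     (ISet 4 (IAdd (IVar 4) (IConst 1)))) (put_ivar 4 0 s) q (t - 1) R"
  proof (rule wp_WHILE[where I = "\<lambda>k s'. \<exists>i. i + k = ?h \<and> s' = put_ivar 4 i s" and k = ?h and q = 0 and t = 1])
    fix k s' assume I: "\<exists>i. i + k = ?h \<and> s' = put_ivar 4 i s"
      "bval (ILess (IAdd (IAdd (IVar 4) (IVar 4)) (IConst 1)) (ISub (IVar 3) (IVar 2))) s'"
    then obtain i where i: "i + k = ?h" "s' = put_ivar 4 i s" "i + i + 1 < ivar s 3 - ivar s 2" by auto
    then obtain k' where "k = Suc k'" by (cases k) auto
    then show "\<exists>k'. k = Suc k' \<and> wp ind ev (ISet 4 (IAdd (IVar 4) (IConst 1))) s' 0 1
        (\<lambda>s'. \<exists>i. i + k' = ?h \<and> s' = put_ivar 4 i s)"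
      using i by (intro exI[of _ k']) (auto intro!: exI[of _ "Suc i"] simp: put_ivar_def)
  next
    fix k s' assume I: "\<exists>i. i + k = ?h \<and> s' = put_ivar 4 i s"
      "\<not> bval (ILess (IAdd (IAdd (IVar 4) (IVar 4)) (IConst 1)) (ISub (IVar 3) (IVar 2))) s'"
    then obtain i where i: "i + k = ?h" "s' = put_ivar 4 i s" "\<not> i + i + 1 < ivar s 3 - ivar s 2" by auto
    then have "i = ?h" by linarith
    then show "R s'" using i assms by simp
  next
    have "?h \<le> n" using assms(1) by linarith
    then show "1 + ?h * (1 + 1) \<le> t - 1" using assms(3) by simp
  qed (auto intro!: exI[of _ 0])
  then show ?thesis using assms(3) unfolding Half_def by simp
qed

definition agree :: "nat set \<Rightarrow> mem \<Rightarrow> mem \<Rightarrow> bool" where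
  "agree X s s' \<longleftrightarrow> (\<forall>y. y \<notin> X \<longrightarrow> ivar s' y = ivar s y)"

definition Search :: "nat list \<Rightarrow> com" where
  "Search ks = WHILE (ILess (IVar 2) (IVar 3))
     (SEQ Half (SEQ (ISet 4 (IAdd (IVar 4) (IVar 2))) (SEQ (ISet 6 (IGet 1 (IVar 4)))
       (SEQ (Less ks (IVar 6) (IVar 1))
         (COND (ILess (IConst 0) (IVar 5)) (ISet 3 (IVar 4)) (ISet 2 (IAdd (IVar 4) (IConst 1))))))))"

text \<open>The list is descending. Entries before index variable 2 rank no lower than the new
  element, entries from index variable 3 on no higher. The interval between them is shorter than
  \<open>2 ^ k\<close> with \<open>k\<close> passes left, so it is empty when none is left.\<close>

lemma wp_Search:
  assumes s: "ivar s 2 = 0" "ivar s 3 = length xs" "\<And>k. k < length xs \<Longrightarrow> iarr s 1 k = xs ! k"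
    and sorted: "sorted_wrt (\<lambda>x y. \<not> key_less (map (rarr s) ks) x y) xs"
    and len: "length xs < 2 ^ L" "length xs \<le> n"
    and fin: "\<And>s' p. rarr s' = rarr s \<Longrightarrow> iarr s' = iarr s \<Longrightarrow> agree {2..6} s s' \<Longrightarrow> ivar s' 2 = p \<Longrightarrow>
      p \<le> length xs \<Longrightarrow> \<forall>x\<in>set (take p xs). \<not> key_less (map (rarr s) ks) x (ivar s 1) \<Longrightarrow>
      \<forall>x\<in>set (drop p xs). \<not> key_less (map (rarr s) ks) (ivar s 1) x \<Longrightarrow> R s'"
    and cost: "L * (2 * length ks) \<le> q" "1 + L * (2 * n + 2 * length ks + 8) \<le> t"
  shows "wp ind ev (Search ks) s q t R"
proof -
  let ?lt = "key_less (map (rarr s) ks)" and ?m = "ivar s 1"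
  define I where "I k s' \<longleftrightarrow> rarr s' = rarr s \<and> iarr s' = iarr s \<and> agree {2..6} s s' \<and>
    ivar s' 3 \<le> length xs \<and> ivar s' 2 \<le> ivar s' 3 \<and> ivar s' 3 - ivar s' 2 < 2 ^ k \<and>
    (\<forall>k<ivar s' 2. \<not> ?lt (xs ! k) ?m) \<and> (\<forall>k<length xs. ivar s' 3 \<le> k \<longrightarrow> \<not> ?lt ?m (xs ! k))" for k s'
  have ge: "\<not> ?lt (xs ! i) (xs ! j)" if "i \<le> j" "j < length xs" for i j
    using sorted that key_less_asym[of "map (rarr s) ks" "xs ! i" "xs ! i"]
    by (cases "i = j") (auto simp: sorted_wrt_iff_nth_less)
  show ?thesis
    unfolding Search_def
  proof (rule wp_WHILE[where I = I and k = L and q = "2 * length ks" and t = "2 * n + 2 * length ks + 7"])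
    show "I L s" using s len by (auto simp: I_def agree_def)
  next
    fix k s' assume I: "I k s'" and b: "bval (ILess (IVar 2) (IVar 3)) s'"
    let ?lo = "ivar s' 2" and ?hi = "ivar s' 3"
    define mid where "mid = (?hi - ?lo) div 2 + ?lo"
    from b have lt: "?lo < ?hi" by simp
    with I obtain k' where k': "k = Suc k'" by (cases k) (auto simp: I_def)
    have mid: "?lo \<le> mid" "mid < ?hi" using lt unfolding mid_def by linarith+
    have half: "mid - ?lo < 2 ^ k'" "?hi - Suc mid < 2 ^ k'"
      using I lt unfolding I_def k' mid_def by auto
    have ml: "mid < length xs" using I mid by (simp add: I_def)
    have m1: "ivar s' 1 = ?m" "rarr s' = rarr s" "iarr s' = iarr s" "agree {2..6} s s'"
      "?hi \<le> length xs" 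
      using I by (auto simp: I_def agree_def)
    have lo: "\<And>k. k < ?lo \<Longrightarrow> \<not> ?lt (xs ! k) ?m" and hi: "\<And>k. k < length xs \<Longrightarrow> ?hi \<le> k \<Longrightarrow> \<not> ?lt ?m (xs ! k)"
      using I by (auto simp: I_def)
    have up: "\<forall>k<length xs. mid \<le> k \<longrightarrow> \<not> ?lt ?m (xs ! k)" if "?lt (xs ! mid) ?m"
      using key_le_trans[OF key_less_asym[OF that] ge] by blast
    have down: "\<forall>k<Suc mid. \<not> ?lt (xs ! k) ?m" if "\<not> ?lt (xs ! mid) ?m"
      using key_le_trans[OF ge that] ml by auto
    have "wp ind ev (SEQ Half (SEQ (ISet 4 (IAdd (IVar 4) (IVar 2))) (SEQ (ISet 6 (IGet 1 (IVar 4)))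
       (SEQ (Less ks (IVar 6) (IVar 1))
         (COND (ILess (IConst 0) (IVar 5)) (ISet 3 (IVar 4)) (ISet 2 (IAdd (IVar 4) (IConst 1)))))))) s'
       (2 * length ks) (2 * n + 2 * length ks + 7) (I k')"
    proof (rule wp_SEQ[where q = 0 and t = "2 + n * 2" and q' = "2 * length ks" and t' = "2 * length ks + 5"])
      show "wp ind ev Half s' 0 (2 + n * 2) (\<lambda>u. u = put_ivar 4 ((?hi - ?lo) div 2) s')"
        using m1 len by (intro wp_Half) auto
    next
      fix u assume u: "u = put_ivar 4 ((?hi - ?lo) div 2) s'"
      have "wp ind ev (SEQ (Less ks (IVar 6) (IVar 1))
         (COND (ILess (IConst 0) (IVar 5)) (ISet 3 (IVar 4)) (ISet 2 (IAdd (IVar 4) (IConst 1)))))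
         (put_ivar 6 (xs ! mid) (put_ivar 4 mid s')) (2 * length ks) (2 * length ks + 3) (I k')"
      proof (rule wp_SEQ[where q' = 0 and t' = 2])
        let ?v = "put_ivar 6 (xs ! mid) (put_ivar 4 mid s')"
        let ?w = "put_ivar 5 (if ?lt (xs ! mid) ?m then 1 else 0) ?v"
        show "wp ind ev (Less ks (IVar 6) (IVar 1)) ?v (2 * length ks) (2 * length ks + 1) (\<lambda>u. u = ?w)"
          using m1 by (intro wp_Less) simp
        have "I k' (put_ivar 3 mid ?w)" if "?lt (xs ! mid) ?m"
          using m1 mid half ml lo up[OF that] by (simp add: I_def agree_def)
        moreover have "I k' (put_ivar 2 (Suc mid) ?w)" if "\<not> ?lt (xs ! mid) ?m"
          using m1 mid half ml hi down[OF that] by (simp add: I_def agree_def)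
        ultimately show "wp ind ev (COND (ILess (IConst 0) (IVar 5)) (ISet 3 (IVar 4)) (ISet 2 (IAdd (IVar 4) (IConst 1)))) u 0 2 (I k')"
          if "u = ?w" for u using that by simp
      qed auto
      then show "wp ind ev (SEQ (ISet 4 (IAdd (IVar 4) (IVar 2))) (SEQ (ISet 6 (IGet 1 (IVar 4)))
       (SEQ (Less ks (IVar 6) (IVar 1))
         (COND (ILess (IConst 0) (IVar 5)) (ISet 3 (IVar 4)) (ISet 2 (IAdd (IVar 4) (IConst 1)))))))
         u (2 * length ks) (2 * length ks + 5) (I k')"
        using u m1 s(3)[OF ml] by (simp add: put_ivar_def mid_def add.commute)
    qed auto
    then show "\<exists>k'. k = Suc k' \<and> wp ind ev (SEQ Half (SEQ (ISet 4 (IAdd (IVar 4) (IVar 2))) (SEQ (ISet 6 (IGet 1 (IVar 4)))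
       (SEQ (Less ks (IVar 6) (IVar 1))
         (COND (ILess (IConst 0) (IVar 5)) (ISet 3 (IVar 4)) (ISet 2 (IAdd (IVar 4) (IConst 1)))))))) s'
       (2 * length ks) (2 * n + 2 * length ks + 7) (I k')" using k' by blast
  next
    fix k s' assume I: "I k s'" and b: "\<not> bval (ILess (IVar 2) (IVar 3)) s'"
    then have "ivar s' 2 = ivar s' 3" by (auto simp: I_def)
    with I show "R s'"
      by (intro fin[of s' "ivar s' 2"]) (auto simp: I_def in_set_conv_nth)
  qed (use cost in \<open>auto simp: algebra_simps\<close>)
qed

definition Shift :: com where
  "Shift = WHILE (ILess (IVar 2) (IVar 3))
     (SEQ (IPut 1 (IVar 3) (IGet 1 (ISub (IVar 3) (IConst 1)))) (ISet 3 (ISub (IVar 3) (IConst 1))))"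

lemma wp_Shift:
  assumes "ivar s 2 = p" "ivar s 3 = m" "p \<le> m" "m \<le> n"
    and "R (s\<lparr>ivar := (ivar s)(3 := p), iarr := (iarr s)(1 := (\<lambda>k. if p < k \<and> k \<le> m then iarr s 1 (k - 1) else iarr s 1 k))\<rparr>)"
    and "1 + n * 3 \<le> t"
  shows "wp ind ev Shift s q t R"
  unfolding Shift_def
proof (rule wp_WHILE[where I = "\<lambda>k s'. p + k \<le> m \<and> s' = s\<lparr>ivar := (ivar s)(3 := p + k),
    iarr := (iarr s)(1 := (\<lambda>j. if p + k < j \<and> j \<le> m then iarr s 1 (j - 1) else iarr s 1 j))\<rparr>"
    and k = "m - p" and q = 0 and t = 2])
  fix k s' assume I: "p + k \<le> m \<and> s' = s\<lparr>ivar := (ivar s)(3 := p + k),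
    iarr := (iarr s)(1 := (\<lambda>j. if p + k < j \<and> j \<le> m then iarr s 1 (j - 1) else iarr s 1 j))\<rparr>"
    "bval (ILess (IVar 2) (IVar 3)) s'"
  then obtain k' where k': "k = Suc k'" using assms(1) by (cases k) auto
  then show "\<exists>k'. k = Suc k' \<and> wp ind ev (SEQ (IPut 1 (IVar 3) (IGet 1 (ISub (IVar 3) (IConst 1)))) (ISet 3 (ISub (IVar 3) (IConst 1))))
    s' 0 2 (\<lambda>s'. p + k' \<le> m \<and> s' = s\<lparr>ivar := (ivar s)(3 := p + k'),
    iarr := (iarr s)(1 := (\<lambda>j. if p + k' < j \<and> j \<le> m then iarr s 1 (j - 1) else iarr s 1 j))\<rparr>)"
    using I by (intro exI[of _ k']) (auto simp: put_ivar_def put_iarr_def fun_eq_iff)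
next
  fix k s' assume I: "p + k \<le> m \<and> s' = s\<lparr>ivar := (ivar s)(3 := p + k),
    iarr := (iarr s)(1 := (\<lambda>j. if p + k < j \<and> j \<le> m then iarr s 1 (j - 1) else iarr s 1 j))\<rparr>"
    "\<not> bval (ILess (IVar 2) (IVar 3)) s'"
  then have "k = 0" using assms(1) by auto
  then show "R s'" using I assms(5) by simp
next
  show "p + (m - p) \<le> m \<and> s = s\<lparr>ivar := (ivar s)(3 := p + (m - p)),
    iarr := (iarr s)(1 := (\<lambda>j. if p + (m - p) < j \<and> j \<le> m then iarr s 1 (j - 1) else iarr s 1 j))\<rparr>"
    using assms(1-4) by (auto simp: fun_eq_iff)
qed (use assms in auto)

text \<open>Binary search spends only logarithmically many comparisons per element. Shifting is
  linear per element, but it consists of index moves and so enters the step count alone.\<close>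

definition Sort :: "nat list \<Rightarrow> com" where
  "Sort ks = For 1 (SEQ (ISet 2 (IConst 0)) (SEQ (ISet 3 (ISub (IVar 1) (IConst 1)))
     (SEQ (Search ks) (SEQ (ISet 3 (ISub (IVar 1) (IConst 1))) (SEQ Shift (IPut 1 (IVar 2) (IVar 1)))))))"

lemma wp_Sort:
  assumes n: "ivar s 0 = n" "n < 2 ^ L"
    and fin: "\<And>s' xs. rarr s' = rarr s \<Longrightarrow> (\<forall>a. a \<noteq> 1 \<longrightarrow> iarr s' a = iarr s a) \<Longrightarrow> agree {1..6} s s' \<Longrightarrow>
      length xs = n \<Longrightarrow> distinct xs \<Longrightarrow> set xs = {1..n} \<Longrightarrow> \<forall>k<n. iarr s' 1 k = xs ! k \<Longrightarrow>
      sorted_wrt (\<lambda>x y. \<not> key_less (map (rarr s) ks) x y) xs \<Longrightarrow> R s'"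
    and cost: "n * (L * (2 * length ks)) \<le> q" "2 + n * (L * (2 * n + 2 * length ks + 8) + 3 * n + 8) \<le> t"
  shows "wp ind ev (Sort ks) s q t R"
proof -
  define I where "I i s' \<longleftrightarrow> rarr s' = rarr s \<and> (\<forall>a. a \<noteq> 1 \<longrightarrow> iarr s' a = iarr s a) \<and> agree {1..6} s s' \<and>
    (\<exists>xs. Suc (length xs) = i \<and> distinct xs \<and> set xs = {1..<i} \<and> (\<forall>k<length xs. iarr s' 1 k = xs ! k) \<and>
      sorted_wrt (\<lambda>x y. \<not> key_less (map (rarr s) ks) x y) xs)" for i s'
  show ?thesis
    unfolding Sort_def
  proof (rule wp_For[where I = I and n = n and q = "L * (2 * length ks)" and t = "L * (2 * n + 2 * length ks + 8) + 3 * n + 6"])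
    show "I 1 (put_ivar 1 1 s)" by (auto simp: I_def agree_def)
  next
    fix i u assume i: "1 \<le> i" "i \<le> n" and "I i u" and u1: "ivar u 1 = i" "ivar u 0 = n"
    then obtain xs where u: "rarr u = rarr s" "\<forall>a. a \<noteq> 1 \<longrightarrow> iarr u a = iarr s a" "agree {1..6} s u"
      and xs: "Suc (length xs) = i" "distinct xs" "set xs = {1..<i}" "\<forall>k<length xs. iarr u 1 k = xs ! k"
       "sorted_wrt (\<lambda>x y. \<not> key_less (map (rarr s) ks) x y) xs"
      by (auto simp: I_def)
    let ?u = "put_ivar 3 (length xs) (put_ivar 2 0 u)"
    let ?Post = "\<lambda>s'. ivar s' 1 = i \<and> ivar s' 0 = n \<and> I (Suc i) (put_ivar 1 (Suc i) s')"
    define Q where "Q s' \<longleftrightarrow> rarr s' = rarr s \<and> iarr s' = iarr u \<and> agree {2..6} u s' \<and> ivar s' 2 \<le> length xs \<and>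
      (\<forall>x\<in>set (take (ivar s' 2) xs). \<not> key_less (map (rarr s) ks) x i) \<and>
      (\<forall>x\<in>set (drop (ivar s' 2) xs). \<not> key_less (map (rarr s) ks) i x)" for s'
    have S: "wp ind ev (Search ks) ?u (L * (2 * length ks)) (1 + L * (2 * n + 2 * length ks + 8)) Q"
      by (rule wp_Search[where xs = xs and n = n and L = L])
        (use xs u u1 i n in \<open>auto simp: Q_def agree_def\<close>)
    have F: "wp ind ev (SEQ (ISet 3 (ISub (IVar 1) (IConst 1))) (SEQ Shift (IPut 1 (IVar 2) (IVar 1)))) v 0 (3 * n + 3) ?Post"
      if "Q v" for v
    proof -
      let ?p = "ivar v 2"
      have v: "rarr v = rarr s" "iarr v = iarr u" "agree {2..6} u v" "?p \<le> length xs"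
        "\<forall>x\<in>set (take ?p xs). \<not> key_less (map (rarr s) ks) x i"
        "\<forall>x\<in>set (drop ?p xs). \<not> key_less (map (rarr s) ks) i x"
        using that by (auto simp: Q_def)
      have v1: "ivar v 1 = i" "ivar v 0 = n" using v u1 by (auto simp: agree_def)
      define v' where "v' = v\<lparr>ivar := (ivar v)(3 := ?p),
        iarr := (iarr v)(1 := (\<lambda>k. if ?p < k \<and> k \<le> length xs then iarr v 1 (k - 1) else iarr v 1 k))\<rparr>"
      define ys where "ys = take ?p xs @ [i] @ drop ?p xs"
      \<comment> \<open>As a multiset, the new list is the old one with \<open>i\<close> added,
        which settles its elements, distinctness and length together.\<close>
      have "mset (take ?p xs) + mset (drop ?p xs) = mset xs" by (simp flip: mset_append)
      then have "mset ys = mset (i # xs)" by (simp add: ys_def)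
      then have ys: "set ys = set (i # xs)" "distinct ys \<longleftrightarrow> distinct (i # xs)" "length ys = length (i # xs)"
        using mset_eq_setD mset_eq_imp_distinct_iff mset_eq_length by blast+
      have "sorted_wrt (\<lambda>x y. \<not> key_less (map (rarr s) ks) x y) (take ?p xs @ drop ?p xs)"
        using xs(5) by simp
      then have sys: "sorted_wrt (\<lambda>x y. \<not> key_less (map (rarr s) ks) x y) ys"
        unfolding ys_def sorted_wrt_append using v(5,6) by auto
      have nth: "iarr (put_iarr 1 ?p i v') 1 k = ys ! k" if "k < length ys" for k
        using that xs(4) v(2,4) ys(3)
        by (auto simp: v'_def ys_def nth_append nth_Cons min_def split: nat.splits intro!: arg_cong[of _ _ "(!) xs"])
      have I: "I (Suc i) (put_ivar 1 (Suc i) (put_iarr 1 ?p i v'))"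
        unfolding I_def
      proof (intro conjI exI[of _ ys])
        show "agree {1..6} s (put_ivar 1 (Suc i) (put_iarr 1 ?p i v'))"
          using v(3) u(3) by (auto simp: agree_def v'_def)
      qed (use v u xs ys sys nth in \<open>auto simp: v'_def\<close>)
      have eq: "put_ivar 3 (length xs) v\<lparr>ivar := (ivar (put_ivar 3 (length xs) v))(3 := ?p),
        iarr := (iarr (put_ivar 3 (length xs) v))(1 := (\<lambda>k. if ?p < k \<and> k \<le> length xs
          then iarr (put_ivar 3 (length xs) v) 1 (k - 1) else iarr (put_ivar 3 (length xs) v) 1 k))\<rparr> = v'"
        by (simp add: v'_def put_ivar_def cong: if_cong)
      have "wp ind ev (SEQ Shift (IPut 1 (IVar 2) (IVar 1))) (put_ivar 3 (length xs) v) 0 (3 * n + 2) ?Post"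
      proof (rule wp_SEQ[where q = 0 and q' = 0 and t' = 1])
        show "wp ind ev Shift (put_ivar 3 (length xs) v) 0 (1 + n * 3) (\<lambda>s'. s' = v')"
          by (rule wp_Shift[where p = ?p and m = "length xs" and n = n])
            (use v xs(1) i eq in auto)
      qed (use I v1 in \<open>auto simp: v'_def\<close>)
      moreover have "ivar v 1 - 1 = length xs" using v1 xs(1) by simp
      ultimately show ?thesis by simp
    qed
    have "wp ind ev (SEQ (Search ks) (SEQ (ISet 3 (ISub (IVar 1) (IConst 1))) (SEQ Shift (IPut 1 (IVar 2) (IVar 1)))))
      ?u (L * (2 * length ks)) (L * (2 * n + 2 * length ks + 8) + 3 * n + 4) ?Post"
      by (rule wp_SEQ[OF S F]) auto
    moreover have "ivar u 1 - 1 = length xs" using u1 xs(1) by simp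
    ultimately show "wp ind ev (SEQ (ISet 2 (IConst 0)) (SEQ (ISet 3 (ISub (IVar 1) (IConst 1)))
     (SEQ (Search ks) (SEQ (ISet 3 (ISub (IVar 1) (IConst 1))) (SEQ Shift (IPut 1 (IVar 2) (IVar 1)))))))
      u (L * (2 * length ks)) (L * (2 * n + 2 * length ks + 8) + 3 * n + 6) ?Post"
      by (auto elim!: wp_mono)
  next
    fix s' assume "I (Suc n) s'"
    then obtain xs where "rarr s' = rarr s" "\<forall>a. a \<noteq> 1 \<longrightarrow> iarr s' a = iarr s a" "agree {1..6} s s'"
      and "length xs = n" "distinct xs" "set xs = {1..<Suc n}" "\<forall>k<length xs. iarr s' 1 k = xs ! k"
       "sorted_wrt (\<lambda>x y. \<not> key_less (map (rarr s) ks) x y) xs"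
      by (auto simp: I_def)
    then show "R s'" by (intro fin[of s' xs]) auto
  qed (use n cost in \<open>auto simp: algebra_simps\<close>)
qed

section \<open>Evaluating one order\<close>

lemma iarr_set_put [simp]:
  "iarr_set a (put_ivar x v s) = iarr_set a s"
  "iarr_set a (put_rarr b i r s) = iarr_set a s"
  "a \<noteq> b \<Longrightarrow> iarr_set a (put_iarr b i v s) = iarr_set a s"
  "iarr_set a (put_iarr a i v s) = (if v = 0 then iarr_set a s - {i} else insert i (iarr_set a s))"
  by (auto simp: iarr_set_def)

lemma iarr_set_cong: "iarr s' a = iarr s a \<Longrightarrow> iarr_set a s' = iarr_set a s"
  by (simp add: iarr_set_def)

definition Greedy :: com where
  "Greedy = SEQ (For 1 (IPut 2 (IVar 1) (IConst 0)))
     (For 1 (SEQ (ISet 6 (IGet 1 (ISub (IVar 1) (IConst 1)))) (SEQ (IPut 2 (IVar 6) (IConst 1))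
       (SEQ (INDEP 3 2) (COND (ILess (IVar 3) (IConst 1)) (IPut 2 (IVar 6) (IConst 0)) SKIP)))))"

lemma fold_greedy_subset: "fold (greedy_add \<B>) xs J \<subseteq> J \<union> set xs"
proof (induction xs arbitrary: J)
  case (Cons x xs)
  show ?case using Cons[of "greedy_add \<B> x J"] by (auto simp: greedy_add_def[of \<B> x J] split: if_splits)
qed simp

text \<open>Array 2 may hold the set of an earlier run; as that set lies in \<open>{1..n}\<close>,
  the first loop clears it entirely. The order starts in cell 0 while the loop counts from 1, hence
  the shift by one.\<close>

lemma wp_Greedy:
  assumes n: "ivar s 0 = n" "iarr_set 2 s \<subseteq> {1..n}"
    and xs: "length xs = n" "distinct xs" "\<forall>k<n. iarr s 1 k = xs ! k"
    and fin: "\<And>s'. rarr s' = rarr s \<Longrightarrow> (\<forall>a. a \<noteq> 2 \<longrightarrow> iarr s' a = iarr s a) \<Longrightarrow> agree {1..6} s s' \<Longrightarrow>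
      iarr_set 2 s' = fold (greedy_add \<B>) xs {} \<Longrightarrow> R s'"
    and cost: "n \<le> q" "4 + n * 10 \<le> t"
  shows "wp (indep \<B>) ev Greedy s q t R"
proof -
  define F where "F s' \<longleftrightarrow> rarr s' = rarr s \<and> (\<forall>a. a \<noteq> 2 \<longrightarrow> iarr s' a = iarr s a) \<and> agree {1..6} s s'" for s'
  have 1: "wp (indep \<B>) ev (For 1 (IPut 2 (IVar 1) (IConst 0))) s 0 (2 + n * 3)
      (\<lambda>s'. F s' \<and> iarr_set 2 s' = {})"
  proof (rule wp_For[where I = "\<lambda>i s'. F s' \<and> iarr_set 2 s' \<subseteq> {i..n}" and n = n and q = 0 and t = 1])
    fix i s' assume i: "1 \<le> i" "i \<le> n" and I: "F s' \<and> iarr_set 2 s' \<subseteq> {i..n}" and "ivar s' 1 = i" "ivar s' 0 = n"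
    moreover have "iarr_set 2 s' - {i} \<subseteq> {Suc i..n}"
    proof
      fix x assume "x \<in> iarr_set 2 s' - {i}"
      moreover from this I have "x \<in> {i..n}" by auto
      ultimately show "x \<in> {Suc i..n}" by (cases "x = i") auto
    qed
    ultimately show "wp (indep \<B>) ev (IPut 2 (IVar 1) (IConst 0)) s' 0 1
      (\<lambda>s'. ivar s' 1 = i \<and> ivar s' 0 = n \<and> F (put_ivar 1 (Suc i) s') \<and> iarr_set 2 (put_ivar 1 (Suc i) s') \<subseteq> {Suc i..n})"
      by (simp add: F_def agree_def)
  qed (use n in \<open>auto simp: F_def agree_def\<close>)
  have 2: "wp (indep \<B>) ev (For 1 (SEQ (ISet 6 (IGet 1 (ISub (IVar 1) (IConst 1)))) (SEQ (IPut 2 (IVar 6) (IConst 1))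
       (SEQ (INDEP 3 2) (COND (ILess (IVar 3) (IConst 1)) (IPut 2 (IVar 6) (IConst 0)) SKIP))))) u n (2 + n * 7) R"
    if u: "F u \<and> iarr_set 2 u = {}" for u
  proof (rule wp_For[where I = "\<lambda>i s'. F s' \<and> iarr_set 2 s' = fold (greedy_add \<B>) (take (i - 1) xs) {}"
        and n = n and q = 1 and t = 5])
    fix i s' assume i: "1 \<le> i" "i \<le> n" and I: "F s' \<and> iarr_set 2 s' = fold (greedy_add \<B>) (take (i - 1) xs) {}"
      and s': "ivar s' 1 = i" "ivar s' 0 = n"
    let ?x = "xs ! (i - 1)" and ?J = "fold (greedy_add \<B>) (take (i - 1) xs) {}"
    have len: "i - 1 < length xs" using i xs by simp
    have tk: "take i xs = take (i - 1) xs @ [?x]"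
      using take_Suc_conv_app_nth[OF len] i by simp
    have "distinct (take (i - 1) xs @ [?x])" using xs(2) tk by (metis distinct_take)
    \<comment> \<open>Rejection writes 0 into cell \<open>?x\<close>; this restores
      \<open>?J\<close> only because \<open>?x\<close> was absent before.\<close>
    then have "?x \<notin> ?J" using fold_greedy_subset[of \<B> "take (i - 1) xs" "{}"] by auto
    moreover have "iarr s' 1 (i - 1) = ?x" using I xs len by (auto simp: F_def)
    moreover have "fold (greedy_add \<B>) (take i xs) {} = (if indep \<B> (insert ?x ?J) then insert ?x ?J else ?J)"
      unfolding tk by (simp add: greedy_add_def[of \<B> "xs ! (i - Suc 0)"])
    ultimately show "wp (indep \<B>) ev (SEQ (ISet 6 (IGet 1 (ISub (IVar 1) (IConst 1)))) (SEQ (IPut 2 (IVar 6) (IConst 1))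
       (SEQ (INDEP 3 2) (COND (ILess (IVar 3) (IConst 1)) (IPut 2 (IVar 6) (IConst 0)) SKIP)))) s' 1 5
       (\<lambda>s'. ivar s' 1 = i \<and> ivar s' 0 = n \<and> F (put_ivar 1 (Suc i) s') \<and>
          iarr_set 2 (put_ivar 1 (Suc i) s') = fold (greedy_add \<B>) (take (Suc i - 1) xs) {})"
      using I s' i by (simp add: F_def agree_def)
  next
    show "ivar u 0 = n" using u n by (auto simp: F_def agree_def)
    show "F (put_ivar 1 1 u) \<and> iarr_set 2 (put_ivar 1 1 u) = fold (greedy_add \<B>) (take (1 - 1) xs) {}"
      using u by (auto simp: F_def agree_def)
  qed (use fin xs in \<open>auto simp: F_def\<close>)
  show ?thesis unfolding Greedy_def
    by (rule wp_SEQ[OF 1 2]) (use cost in auto)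
qed

section \<open>The weight vector of the greedy basis\<close>

definition Coord :: "nat \<Rightarrow> nat \<Rightarrow> com" where
  "Coord d a = SEQ (RPut d (IConst a) (RConst 0)) (For 1 (COND (ILess (IConst 0) (IGet 2 (IVar 1)))
     (RPut d (IConst a) (RAdd (RGet d (IConst a)) (RGet a (IVar 1)))) SKIP))"

lemma wp_Coord:
  assumes n: "ivar s 0 = n" "iarr_set 2 s \<subseteq> {1..n}" "a \<noteq> d"
    and R: "R (put_ivar 1 (Suc n) (put_rarr d a (\<Sum>j\<in>iarr_set 2 s. rarr s a j) s))"
    and cost: "n \<le> q" "3 + n * 4 \<le> t"
  shows "wp ind ev (Coord d a) s q t R"
proof -
  let ?J = "iarr_set 2 s"
  define S where "S i = (\<Sum>j\<in>?J \<inter> {1..<i}. rarr s a j)" for i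
  have S: "S (Suc i) = (if i \<in> ?J then S i + rarr s a i else S i)" if "1 \<le> i" for i
  proof (cases "i \<in> ?J")
    case True
    then have "?J \<inter> {1..<Suc i} = insert i (?J \<inter> {1..<i})" using that by auto
    then show ?thesis using True by (simp add: S_def)
  next
    case False
    then have "?J \<inter> {1..<Suc i} = ?J \<inter> {1..<i}" by (auto simp: less_Suc_eq)
    then show ?thesis using False by (simp add: S_def)
  qed
  have "wp ind ev (For 1 (COND (ILess (IConst 0) (IGet 2 (IVar 1)))
     (RPut d (IConst a) (RAdd (RGet d (IConst a)) (RGet a (IVar 1)))) SKIP)) (put_rarr d a 0 s) n (2 + n * 4) R"
  proof (rule wp_For[where I = "\<lambda>i s'. s' = put_ivar 1 i (put_rarr d a (S i) s)" and n = n and q = 1 and t = 2])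
    show "put_ivar 1 1 (put_rarr d a 0 s) = put_ivar 1 1 (put_rarr d a (S 1) s)" by (simp add: S_def)
  next
    fix i s' assume i: "1 \<le> i" "i \<le> n" and "s' = put_ivar 1 i (put_rarr d a (S i) s)"
    then show "wp ind ev (COND (ILess (IConst 0) (IGet 2 (IVar 1)))
     (RPut d (IConst a) (RAdd (RGet d (IConst a)) (RGet a (IVar 1)))) SKIP) s' 1 2
     (\<lambda>s'. ivar s' 1 = i \<and> ivar s' 0 = n \<and> put_ivar 1 (Suc i) s' = put_ivar 1 (Suc i) (put_rarr d a (S (Suc i)) s))"
      using n S[OF i(1)] by (auto simp: iarr_set_def put_ivar_def put_rarr_def)
  next
    fix s' assume s': "s' = put_ivar 1 (Suc n) (put_rarr d a (S (Suc n)) s)"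
    have "?J \<inter> {1..<Suc n} = ?J" using n(2) by auto
    then show "R s'" using s' R by (simp add: S_def)
  qed (use n in auto)
  then show ?thesis unfolding Coord_def using cost by (auto elim!: wp_mono)
qed

definition Point :: "nat \<Rightarrow> com" where
  "Point d = Seqs (map (Coord d) [0..<d])"

lemma wp_Point:
  assumes n: "ivar s 0 = n" "iarr_set 2 s \<subseteq> {1..n}"
    and fin: "\<And>s'. (\<forall>a. a \<noteq> d \<longrightarrow> rarr s' a = rarr s a) \<Longrightarrow> iarr s' = iarr s \<Longrightarrow> agree {1} s s' \<Longrightarrow>
       (\<forall>a<d. rarr s' d a = (\<Sum>j\<in>iarr_set 2 s. rarr s a j)) \<Longrightarrow> R s'"
    and cost: "d * n \<le> q" "1 + d * (3 + n * 4) \<le> t"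
  shows "wp ind ev (Point d) s q t R"
  unfolding Point_def
proof (rule wp_Seqs[where I = "\<lambda>k s'. (\<forall>a. a \<noteq> d \<longrightarrow> rarr s' a = rarr s a) \<and> iarr s' = iarr s \<and> agree {1} s s' \<and>
       (\<forall>a<k. rarr s' d a = (\<Sum>j\<in>iarr_set 2 s. rarr s a j))" and q = n and t = "3 + n * 4"])
  fix k s' assume k: "k < length (map (Coord d) [0..<d])"
    and I: "(\<forall>a. a \<noteq> d \<longrightarrow> rarr s' a = rarr s a) \<and> iarr s' = iarr s \<and> agree {1} s s' \<and>
       (\<forall>a<k. rarr s' d a = (\<Sum>j\<in>iarr_set 2 s. rarr s a j))"
  then have "wp ind ev (Coord d k) s' n (3 + n * 4)
     (\<lambda>s'. (\<forall>a. a \<noteq> d \<longrightarrow> rarr s' a = rarr s a) \<and> iarr s' = iarr s \<and> agree {1} s s' \<and>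
       (\<forall>a<Suc k. rarr s' d a = (\<Sum>j\<in>iarr_set 2 s. rarr s a j)))"
    using n iarr_set_cong[of s' 2 s] by (intro wp_Coord[where n = n]) (auto simp: agree_def less_Suc_eq)
  then show "wp ind ev (map (Coord d) [0..<d] ! k) s' n (3 + n * 4)
     (\<lambda>s'. (\<forall>a. a \<noteq> d \<longrightarrow> rarr s' a = rarr s a) \<and> iarr s' = iarr s \<and> agree {1} s s' \<and>
       (\<forall>a<Suc k. rarr s' d a = (\<Sum>j\<in>iarr_set 2 s. rarr s a j)))"
    using k by simp
qed (use fin cost in \<open>auto simp: agree_def\<close>)

section \<open>Keeping the best basis\<close>

definition Copy :: "nat \<Rightarrow> com" where
  "Copy d = SEQ (For 1 (IPut 0 (IVar 1) (IGet 2 (IVar 1))))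
     (SEQ (RPut (d + 1) (IConst 0) (RGet (d + 1) (IConst 1))) (ISet 9 (IConst 1)))"

text \<open>No constant lies below all values of \<open>c\<close>, so the first candidate is stored
  unconditionally and index variable 9 remembers that this has happened.\<close>

definition Update :: "nat \<Rightarrow> com" where
  "Update d = COND (ILess (IConst 0) (IVar 9))
     (COND (RLess (RGet (d + 1) (IConst 0)) (RGet (d + 1) (IConst 1))) (Copy d) SKIP) (Copy d)"

lemma wp_Copy:
  assumes n: "ivar s 0 = n" "iarr_set 2 s \<subseteq> {1..n}" "iarr_set 0 s \<subseteq> {1..n}"
    and fin: "\<And>s'. (\<forall>a. a \<noteq> d + 1 \<longrightarrow> rarr s' a = rarr s a) \<Longrightarrow> (\<forall>a. a \<noteq> 0 \<longrightarrow> iarr s' a = iarr s a) \<Longrightarrow>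
       agree {1,9} s s' \<Longrightarrow> rarr s' (d + 1) 0 = rarr s (d + 1) 1 \<Longrightarrow> iarr_set 0 s' = iarr_set 2 s \<Longrightarrow>
       ivar s' 9 = 1 \<Longrightarrow> R s'"
    and cost: "4 + n * 3 \<le> t"
  shows "wp ind ev (Copy d) s q t R"
  unfolding Copy_def
proof (rule wp_SEQ[where q = 0 and t = "2 + n * 3" and q' = 0 and t' = 2])
  show "wp ind ev (For 1 (IPut 0 (IVar 1) (IGet 2 (IVar 1)))) s 0 (2 + n * 3)
    (\<lambda>s'. rarr s' = rarr s \<and> (\<forall>a. a \<noteq> 0 \<longrightarrow> iarr s' a = iarr s a) \<and> agree {1} s s' \<and> iarr_set 0 s' = iarr_set 2 s)"
  proof (rule wp_For[where I = "\<lambda>i s'. rarr s' = rarr s \<and> (\<forall>a. a \<noteq> 0 \<longrightarrow> iarr s' a = iarr s a) \<and> agree {1} s s' \<and>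
      (\<forall>j. iarr s' 0 j = (if 1 \<le> j \<and> j < i then iarr s 2 j else iarr s 0 j))" and n = n and q = 0 and t = 1])
    fix s' assume I: "rarr s' = rarr s \<and> (\<forall>a. a \<noteq> 0 \<longrightarrow> iarr s' a = iarr s a) \<and> agree {1} s s' \<and>
      (\<forall>j. iarr s' 0 j = (if 1 \<le> j \<and> j < Suc n then iarr s 2 j else iarr s 0 j))"
    have "iarr_set 0 s' = iarr_set 2 s" using I n by (auto simp: iarr_set_def less_Suc_eq_le)
    with I show "rarr s' = rarr s \<and> (\<forall>a. a \<noteq> 0 \<longrightarrow> iarr s' a = iarr s a) \<and> agree {1} s s' \<and> iarr_set 0 s' = iarr_set 2 s"
      by blast
  qed (use n in \<open>auto simp: agree_def less_Suc_eq\<close>)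
next
  fix s' assume "rarr s' = rarr s \<and> (\<forall>a. a \<noteq> 0 \<longrightarrow> iarr s' a = iarr s a) \<and> agree {1} s s' \<and> iarr_set 0 s' = iarr_set 2 s"
  then show "wp ind ev (SEQ (RPut (d + 1) (IConst 0) (RGet (d + 1) (IConst 1))) (ISet 9 (IConst 1))) s' 0 2 R"
    by (auto intro!: fin simp: agree_def)
qed (use cost in auto)

definition Leaf :: "nat \<Rightarrow> nat list \<Rightarrow> com" where
  "Leaf d ks = SEQ (Sort ks) (SEQ Greedy (SEQ (Point d) (SEQ (EVAL (d + 1) (IConst 1) d) (Update d))))"

definition leaf_queries :: "nat \<Rightarrow> nat \<Rightarrow> nat \<Rightarrow> nat" where
  "leaf_queries d n L = n * (L * (2 * d)) + n + d * n + 2"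

definition leaf_steps :: "nat \<Rightarrow> nat \<Rightarrow> nat \<Rightarrow> nat" where
  "leaf_steps d n L = n * (L * (2 * n + 2 * d + 8) + 3 * n + 8) + n * 10 + d * (3 + n * 4) + 3 * n + 14"

text \<open>The program does not know \<open>l\<close>. It is the functional whose chamber the
  enumeration has to hit, and maximizing it over the bases is enough for optimality.\<close>

locale convex_matroid_problem =
  fixes ix :: "'d::finite \<Rightarrow> nat" and d n :: nat and \<B> :: "nat set set"
    and w :: "nat \<Rightarrow> real ^ 'd" and c :: "real ^ 'd \<Rightarrow> real" and l :: "real ^ 'd"
  assumes ix: "bij_betw ix UNIV {..<d}"
    and M: "matroid {1..n} \<B>"
    and l: "B \<in> \<B> \<Longrightarrow> (\<And>A. A \<in> \<B> \<Longrightarrow> l \<bullet> sum w A \<le> l \<bullet> sum w B) \<Longrightarrow> optimal_basis \<B> w c B"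
begin

text \<open>The flag \<open>b\<close> records that a leaf inducing the order of \<open>l\<close> has been visited.\<close>

definition best_so_far :: "bool \<Rightarrow> mem \<Rightarrow> bool" where
  "best_so_far b s \<longleftrightarrow> ivar s 0 = n \<and> (\<forall>a<d. \<forall>j\<in>{1..n}. rarr s a j = w j $ inv ix a) \<and>
     iarr_set 2 s \<subseteq> {1..n} \<and>
     (if ivar s 9 = 0 then \<not> b \<and> iarr_set 0 s = {}
      else iarr_set 0 s \<in> \<B> \<and> rarr s (d + 1) 0 = c (sum w (iarr_set 0 s)) \<and>
        (b \<longrightarrow> optimal_basis \<B> w c (iarr_set 0 s)))"

text \<open>Read contrapositively: a list sorted downwards by the keys is sorted downwards by
  \<open>l\<close>, which is what greedy optimality asks for.\<close>

definition good_keys :: "(nat \<Rightarrow> real) list \<Rightarrow> bool" where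
  "good_keys ks \<longleftrightarrow> (\<forall>i\<in>{1..n}. \<forall>j\<in>{1..n}. l \<bullet> w i < l \<bullet> w j \<longrightarrow> key_less ks i j)"

text \<open>Loop variables from \<open>v\<close> and arrays from \<open>f\<close> on belong to the
  current subtree of the enumeration; what lies below them is owned by its ancestors and has to
  survive. Arrays \<open>d\<close> and \<open>d + 1\<close> and the low index variables are shared
  working space.\<close>

definition frame :: "nat \<Rightarrow> nat \<Rightarrow> mem \<Rightarrow> mem \<Rightarrow> bool" where
  "frame v f s s' \<longleftrightarrow> (\<forall>y. y = 0 \<or> 10 \<le> y \<and> y < v \<longrightarrow> ivar s' y = ivar s y) \<and>
     (\<forall>a. a < d \<or> d + 2 \<le> a \<and> a < f \<longrightarrow> rarr s' a = rarr s a)"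

lemma eval_point:
  assumes "\<forall>a<d. p a = (\<Sum>j\<in>J. w j $ inv ix a)"
  shows "eval_oracle ix c p = c (sum w J)"
proof -
  have "p (ix i) = (\<Sum>j\<in>J. w j $ i)" for i
  proof -
    have "ix i < d" using ix by (auto simp: bij_betw_def)
    moreover have "inv ix (ix i) = i" using ix by (simp add: bij_betw_def)
    ultimately show ?thesis using assms by simp
  qed
  then have "(\<chi> i. p (ix i)) = sum w J" by (simp add: vec_eq_iff sum_component)
  then show ?thesis by (simp add: eval_oracle_def)
qed

text \<open>Any order yields a basis, hence a legitimate candidate; good keys make it optimal.
  Comparing by value never loses an optimum already stored.\<close>

lemma wp_Leaf:
  assumes s: "best_so_far b s" and L: "n < 2 ^ L" and len: "length ks = d"
  shows "wp (indep \<B>) (eval_oracle ix c) (Leaf d ks) s (leaf_queries d n L) (leaf_steps d n L)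
    (\<lambda>s'. frame v f s s' \<and> best_so_far (b \<or> good_keys (map (rarr s) ks)) s')"
    (is "wp ?ind ?ev _ _ _ _ ?R")
proof -
  let ?lt = "key_less (map (rarr s) ks)"
  have s0: "ivar s 0 = n" "iarr_set 2 s \<subseteq> {1..n}" "\<And>a j. a < d \<Longrightarrow> j \<in> {1..n} \<Longrightarrow> rarr s a j = w j $ inv ix a"
    using s by (auto simp: best_so_far_def)
  have out: "iarr_set 0 s \<subseteq> {1..n}"
    using s matroid_finite(3)[OF M] by (auto simp: best_so_far_def split: if_splits)
  define Q1 where "Q1 u \<longleftrightarrow> rarr u = rarr s \<and> (\<forall>a. a \<noteq> 1 \<longrightarrow> iarr u a = iarr s a) \<and> agree {1..6} s u \<and>
    (\<exists>xs. length xs = n \<and> distinct xs \<and> set xs = {1..n} \<and> (\<forall>k<n. iarr u 1 k = xs ! k) \<and>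
      sorted_wrt (\<lambda>x y. \<not> ?lt x y) xs)" for u
  define Q2 where "Q2 u \<longleftrightarrow> rarr u = rarr s \<and> iarr u 0 = iarr s 0 \<and> agree {1..6} s u \<and>
    iarr_set 2 u \<in> \<B> \<and> (good_keys (map (rarr s) ks) \<longrightarrow> optimal_basis \<B> w c (iarr_set 2 u))" for u
  define Q3 where "Q3 u \<longleftrightarrow> (\<forall>a. a \<noteq> d \<longrightarrow> rarr u a = rarr s a) \<and> iarr u 0 = iarr s 0 \<and> agree {1..6} s u \<and>
    iarr_set 2 u \<in> \<B> \<and> (good_keys (map (rarr s) ks) \<longrightarrow> optimal_basis \<B> w c (iarr_set 2 u)) \<and>
    eval_oracle ix c (rarr u d) = c (sum w (iarr_set 2 u))" for u
  have 1: "wp ?ind ?ev (Sort ks) s (n * (L * (2 * d))) (2 + n * (L * (2 * n + 2 * d + 8) + 3 * n + 8)) Q1"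
    by (rule wp_Sort[where n = n and L = L]) (use s0 L len in \<open>auto simp: Q1_def\<close>)
  have 2: "wp ?ind ?ev Greedy u n (4 + n * 10) Q2" if u: "Q1 u" for u
  proof -
    from u obtain xs where xs: "length xs = n" "distinct xs" "set xs = {1..n}" "\<forall>k<n. iarr u 1 k = xs ! k"
      "sorted_wrt (\<lambda>x y. \<not> ?lt x y) xs" by (auto simp: Q1_def)
    let ?J = "fold (greedy_add \<B>) xs {}"
    \<comment> \<open>With constant weight 0 every list is sorted, so this holds whatever the keys
      are.\<close>
    have J: "?J \<in> \<B>"
      using greedy_optimal(1)[OF M xs(2,3), of "\<lambda>_. 0"] by (simp add: sorted_wrt_iff_nth_less)
    moreover have "optimal_basis \<B> w c ?J" if g: "good_keys (map (rarr s) ks)"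
    proof (rule l[OF J])
      fix A assume "A \<in> \<B>"
      have "sorted_wrt (\<lambda>x y. l \<bullet> w y \<le> l \<bullet> w x) xs"
        by (rule sorted_wrt_mono_rel[OF _ xs(5)])
          (use g xs(3) in \<open>auto simp: good_keys_def not_less[symmetric]\<close>)
      from greedy_optimal(2)[OF M xs(2,3) this \<open>A \<in> \<B>\<close>]
      show "l \<bullet> sum w A \<le> l \<bullet> sum w ?J" by (simp add: inner_sum_right)
    qed
    moreover have "ivar u 0 = n" "iarr_set 2 u \<subseteq> {1..n}"
      using u s0 iarr_set_cong[of u 2 s] by (auto simp: Q1_def agree_def)
    ultimately show ?thesis
      using u xs by (intro wp_Greedy[where xs = xs and n = n]) (auto simp: Q1_def Q2_def agree_def)
  qed
  have 3: "wp ?ind ?ev (Point d) u (d * n) (1 + d * (3 + n * 4)) Q3" if u: "Q2 u" for u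
  proof (rule wp_Point[where n = n])
    show "ivar u 0 = n" using u s0 by (auto simp: Q2_def agree_def)
    show J: "iarr_set 2 u \<subseteq> {1..n}" using u matroid_finite(3)[OF M] by (auto simp: Q2_def)
    fix u' assume u': "\<forall>a. a \<noteq> d \<longrightarrow> rarr u' a = rarr u a" "iarr u' = iarr u" "agree {1} u u'"
       "\<forall>a<d. rarr u' d a = (\<Sum>j\<in>iarr_set 2 u. rarr u a j)"
    have "\<forall>a<d. rarr u' d a = (\<Sum>j\<in>iarr_set 2 u. w j $ inv ix a)"
    proof (intro allI impI)
      fix a assume "a < d"
      then show "rarr u' d a = (\<Sum>j\<in>iarr_set 2 u. w j $ inv ix a)"
        using u'(4) u J s0(3) by (auto simp: Q2_def intro!: sum.cong)
    qed
    from eval_point[OF this] show "Q3 u'"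
      using u u' iarr_set_cong[of u' 2 u] by (auto simp: Q2_def Q3_def agree_def)
  qed auto
  have 4: "wp ?ind ?ev (SEQ (EVAL (d + 1) (IConst 1) d) (Update d)) u 2 (7 + n * 3) ?R" if u: "Q3 u" for u
  proof -
    let ?J = "iarr_set 2 u" and ?O = "iarr_set 0 s"
    define v where "v = put_rarr (d + 1) 1 (c (sum w ?J)) u"
    have J: "?J \<in> \<B>" "?J \<subseteq> {1..n}" and Jopt: "good_keys (map (rarr s) ks) \<Longrightarrow> optimal_basis \<B> w c ?J"
      using u matroid_finite(3)[OF M] by (auto simp: Q3_def)
    have v: "\<forall>a. a \<noteq> d \<and> a \<noteq> d + 1 \<longrightarrow> rarr v a = rarr s a" "rarr v (d + 1) 1 = c (sum w ?J)"
      "rarr v (d + 1) 0 = rarr s (d + 1) 0" "iarr_set 2 v = ?J" "iarr_set 0 v = ?O" "agree {1..6} s v"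
      using u iarr_set_cong[of u 0 s] by (auto simp: Q3_def v_def agree_def)
    have v0: "ivar v 0 = n" "ivar v 9 = ivar s 9" using v(6) s0 by (auto simp: agree_def)
    have cp: "wp ?ind ?ev (Copy d) v 0 (4 + n * 3) ?R"
      if better: "b \<Longrightarrow> optimal_basis \<B> w c ?J"
    proof (rule wp_Copy[where n = n])
      fix s' assume s': "\<forall>a. a \<noteq> d + 1 \<longrightarrow> rarr s' a = rarr v a" "\<forall>a. a \<noteq> 0 \<longrightarrow> iarr s' a = iarr v a"
       "agree {1, 9} v s'" "rarr s' (d + 1) 0 = rarr v (d + 1) 1" "iarr_set 0 s' = iarr_set 2 v" "ivar s' 9 = 1"
      have "best_so_far (b \<or> good_keys (map (rarr s) ks)) s'"
        using s' v v0 s0 J Jopt better iarr_set_cong[of s' 2 v] by (auto simp: best_so_far_def agree_def)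
      moreover have "frame v' f s s'" for v' using s' v by (auto simp: frame_def agree_def)
      ultimately show "?R s'" by blast
    qed (use v v0 J out in auto)
    have keep: "?R v" if "ivar s 9 \<noteq> 0" "\<not> rarr s (d + 1) 0 < c (sum w ?J)"
    proof -
      have O: "?O \<in> \<B>" "rarr s (d + 1) 0 = c (sum w ?O)" "b \<longrightarrow> optimal_basis \<B> w c ?O"
        using s that by (auto simp: best_so_far_def)
      \<comment> \<open>An optimal candidate that is not strictly better forces the stored basis to
        have the same value.\<close>
      have "optimal_basis \<B> w c ?O" if "good_keys (map (rarr s) ks)"
        using Jopt[OF that] O \<open>\<not> rarr s (d + 1) 0 < c (sum w ?J)\<close> unfolding optimal_basis_def
        by (metis not_less order_trans)
      then have "best_so_far (b \<or> good_keys (map (rarr s) ks)) v"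
        using v v0 s0 J O that by (auto simp: best_so_far_def agree_def)
      moreover have "frame v' f s v" for v' using v by (auto simp: frame_def agree_def)
      ultimately show ?thesis by blast
    qed
    \<comment> \<open>The premises contradict each other: under \<open>b\<close> the stored basis is
      optimal and cannot be beaten.\<close>
    have "optimal_basis \<B> w c ?J" if "ivar s 9 \<noteq> 0" "rarr s (d + 1) 0 < c (sum w ?J)" b
      using s that J by (fastforce simp: best_so_far_def optimal_basis_def)
    moreover have "\<not> b" if "ivar s 9 = 0" using s that by (auto simp: best_so_far_def)
    ultimately have "wp ?ind ?ev (Update d) v 1 (6 + n * 3) ?R"
      using v(2,3) v0 keep by (auto simp: Update_def intro!: wp_mono[OF cp])
    moreover have "put_rarr (d + 1) 1 (eval_oracle ix c (rarr u d)) u = v"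
      using u by (simp add: v_def Q3_def)
    ultimately show ?thesis by simp
  qed
  have "wp ?ind ?ev (SEQ (Point d) (SEQ (EVAL (d + 1) (IConst 1) d) (Update d))) u
      (d * n + 2) (1 + d * (3 + n * 4) + (7 + n * 3)) ?R" if "Q2 u" for u
    by (rule wp_SEQ[OF 3[OF that] 4]) auto
  then have "wp ?ind ?ev (SEQ Greedy (SEQ (Point d) (SEQ (EVAL (d + 1) (IConst 1) d) (Update d)))) u
      (n + (d * n + 2)) (4 + n * 10 + (1 + d * (3 + n * 4) + (7 + n * 3))) ?R" if "Q1 u" for u
    using wp_SEQ[OF 2[OF that]] by blast
  then show ?thesis unfolding Leaf_def
    by (rule wp_SEQ[OF 1]) (auto simp: leaf_queries_def leaf_steps_def)
qed

end

section \<open>Enumeration of the chambers\<close>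

text \<open>With \<open>g = w i - w j\<close>, the number \<open>r \<bullet> g\<close> is a
  difference of two cells of the array of \<open>r\<close>. Variables \<open>v\<close> and
  \<open>v + 1\<close> hold \<open>i\<close> and \<open>j\<close>; array \<open>f\<close> receives
  the pivot, and the arrays after it the projected rows. A zero divisor yields the zero pivot, as in
  \<open>pivot\<close>.\<close>

definition Eliminate :: "nat \<Rightarrow> nat list \<Rightarrow> nat \<Rightarrow> nat \<Rightarrow> com" where
  "Eliminate p as f v =
     SEQ (For (v + 2) (RPut f (IVar (v + 2)) (RDiv (RGet (as ! p) (IVar (v + 2)))
            (RSub (RGet (as ! p) (IVar v)) (RGet (as ! p) (IVar (v + 1)))))))
       (Seqs (map (\<lambda>m. For (v + 2) (RPut (f + 1 + m) (IVar (v + 2))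
            (RSub (RGet (drop_nth p as ! m) (IVar (v + 2)))
              (RMul (RSub (RGet (drop_nth p as ! m) (IVar v)) (RGet (drop_nth p as ! m) (IVar (v + 1))))
                (RGet f (IVar (v + 2))))))) [0..<length as - 1]))"

text \<open>\<open>as\<close> names the rows spanning the current face, \<open>ks\<close> the
  retired pivots. Deeper faces give more significant keys, so each new pivot, and finally the signed
  last row, goes to the front of the keys.\<close>

primrec Node :: "nat \<Rightarrow> nat \<Rightarrow> nat list \<Rightarrow> nat list \<Rightarrow> nat \<Rightarrow> nat \<Rightarrow> com" where
  "Node d 0 as ks f v = Seqs (map (\<lambda>\<sigma>.
     SEQ (For v (RPut f (IVar v) (RMul (RConst \<sigma>) (RGet (hd as) (IVar v))))) (Leaf d (f # ks))) [1, - 1])"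
| "Node d (Suc k) as ks f v = Seqs (map (\<lambda>p. For v (For (v + 1)
     (SEQ (Eliminate p as f v) (Node d k [f + 1..<f + length as] (f # ks) (f + length as) (v + 3)))))
     [0..<length as])"

text \<open>A level branches over \<open>n * n\<close> pairs and over the pivot rows. The number of
  rows shrinks with depth, but bounding it by \<open>d\<close> throughout costs only a constant
  factor.\<close>

primrec node_queries :: "nat \<Rightarrow> nat \<Rightarrow> nat \<Rightarrow> nat \<Rightarrow> nat" where
  "node_queries d 0 n L = 2 * (n + leaf_queries d n L)"
| "node_queries d (Suc k) n L = d * (n * (n * (d * (n * 3) + node_queries d k n L)))"

primrec node_steps :: "nat \<Rightarrow> nat \<Rightarrow> nat \<Rightarrow> nat \<Rightarrow> nat" where
  "node_steps d 0 n L = 1 + 2 * (2 + n * 3 + leaf_steps d n L)"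
| "node_steps d (Suc k) n L =
     1 + d * (2 + n * ((2 + n * ((1 + d * (2 + n * 3) + node_steps d k n L) + 2)) + 2))"

section \<open>Correctness of the enumeration\<close>

lemma length_drop_nth: "p < length xs \<Longrightarrow> length (drop_nth p xs) = length xs - 1"
  by (simp add: drop_nth_def)

lemma list_all2_drop_nth: "list_all2 P xs ys \<Longrightarrow> list_all2 P (drop_nth p xs) (drop_nth p ys)"
  by (simp add: drop_nth_def list_all2_appendI list_all2_takeI list_all2_dropI)

context convex_matroid_problem
begin

abbreviation "D \<equiv> (\<lambda>(i,j). w i - w j) ` ({1..n} \<times> {1..n})"

definition row :: "mem \<Rightarrow> nat \<Rightarrow> real ^ 'd \<Rightarrow> bool" where
  "row s a r \<longleftrightarrow> (\<forall>j\<in>{1..n}. rarr s a j = r \<bullet> w j)"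

lemma row_cong: "rarr s' a = rarr s a \<Longrightarrow> row s a r \<Longrightarrow> row s' a r"
  by (simp add: row_def)

lemma rows_cong:
  assumes "list_all2 (row s) as rs" "\<And>a. a \<in> set as \<Longrightarrow> rarr s' a = rarr s a"
  shows "list_all2 (row s') as rs"
  using assms by (auto simp: list_all2_conv_all_nth intro: row_cong)

lemma frame_refl: "frame v f s s"
  by (simp add: frame_def)

lemma frame_trans: "frame v f s s' \<Longrightarrow> frame v f s' s'' \<Longrightarrow> frame v f s s''"
  by (simp add: frame_def)

lemma frame_mono: "frame v' f' s s' \<Longrightarrow> v \<le> v' \<Longrightarrow> f \<le> f' \<Longrightarrow> frame v f s s'"
  by (auto simp: frame_def)

lemma best_so_far_cong:
  assumes "best_so_far b s" "ivar s' 0 = ivar s 0" "ivar s' 9 = ivar s 9" "iarr s' = iarr s"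
    and "\<And>a. a < d + 2 \<Longrightarrow> rarr s' a = rarr s a"
  shows "best_so_far b s'"
proof -
  have "iarr_set a s' = iarr_set a s" for a by (rule iarr_set_cong) (simp add: assms(4))
  moreover have "rarr s' (d + 1) = rarr s (d + 1)" "\<And>a. a < d \<Longrightarrow> rarr s' a = rarr s a"
    using assms(5) by simp_all
  ultimately show ?thesis using assms(1-3) by (simp add: best_so_far_def cong: if_cong)
qed

lemma best_so_far_mono: "best_so_far b s \<Longrightarrow> (b' \<Longrightarrow> b) \<Longrightarrow> best_so_far b' s"
  by (auto simp: best_so_far_def split: if_splits)

text \<open>\<open>k \<bullet> w i < k \<bullet> w j\<close> is positivity of \<open>k\<close> on
  \<open>w j - w i\<close>, and ties correspond to value 0; this links the order seen by the program
  to the geometry of the arrangement.\<close>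

lemma key_less_lexpos:
  assumes "list_all2 (row s) ks vs" "i \<in> {1..n}" "j \<in> {1..n}"
  shows "key_less (map (rarr s) ks) i j \<longleftrightarrow> lexpos vs (w j - w i)"
  using assms(1) by (induction rule: list_all2_induct)
    (use assms(2,3) in \<open>auto simp: row_def inner_diff_right not_less\<close>)

lemma wp_row:
  assumes s: "best_so_far b s" and x: "10 \<le> x" "x = v \<or> v < x" "d + 2 \<le> f"
    and e: "\<And>j s'. 1 \<le> j \<Longrightarrow> j \<le> n \<Longrightarrow> ivar s' = (ivar s)(x := j) \<Longrightarrow>
        (\<And>a. a \<noteq> f \<Longrightarrow> rarr s' a = rarr s a) \<Longrightarrow> rval e s' = r \<bullet> w j"
    and cost: "rcost e \<le> q"
  shows "wp ind ev (For x (RPut f (IVar x) e)) s (n * q) (2 + n * 3)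
    (\<lambda>s'. best_so_far b s' \<and> frame x f s s' \<and> (\<forall>a. a \<noteq> f \<longrightarrow> rarr s' a = rarr s a) \<and> row s' f r)"
proof (rule wp_fill[where n = n and F = "\<lambda>j. r \<bullet> w j"])
  show "x \<noteq> 0" using x by simp
  show n: "ivar s 0 = n" using s by (simp add: best_so_far_def)
  let ?s' = "s\<lparr>ivar := (ivar s)(x := Suc n),
     rarr := (rarr s)(f := \<lambda>j. if 1 \<le> j \<and> j \<le> n then r \<bullet> w j else rarr s f j)\<rparr>"
  have "best_so_far b ?s'" by (rule best_so_far_cong[OF s]) (use x in auto)
  then show "best_so_far b ?s' \<and> frame x f s ?s' \<and> (\<forall>a. a \<noteq> f \<longrightarrow> rarr ?s' a = rarr s a) \<and> row ?s' f r"
    using x by (auto simp: frame_def row_def)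
qed (use e cost in auto)

lemma wp_Eliminate:
  assumes s: "best_so_far b s" and as: "list_all2 (row s) as rs" "\<And>a. a \<in> set as \<Longrightarrow> a < f" "p < length as"
    and ij: "ivar s v = i" "ivar s (v + 1) = j" "i \<in> {1..n}" "j \<in> {1..n}"
    and vf: "10 \<le> v" "d + 2 \<le> f" and len: "length as \<le> d"
  shows "wp ind ev (Eliminate p as f v) s (d * (n * 3)) (1 + d * (2 + n * 3))
    (\<lambda>s'. best_so_far b s' \<and> frame (v + 2) f s s' \<and> (\<forall>a<f. rarr s' a = rarr s a) \<and>
      row s' f (pivot p (w i - w j) rs) \<and>
      list_all2 (row s') [f + 1..<f + length as] (eliminate p (w i - w j) rs))"
proof -
  let ?g = "w i - w j"
  let ?T = "pivot p ?g rs" and ?E = "eliminate p ?g rs" and ?qs = "drop_nth p as"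
  have lr: "length rs = length as" using as(1) list_all2_lengthD by fastforce
  have qs: "list_all2 (row s) ?qs (drop_nth p rs)" using as(1) by (rule list_all2_drop_nth)
  have lq: "length ?qs = length as - 1" "length ?E = length as - 1"
    using as(3) lr by (simp_all add: length_drop_nth eliminate_def)
  have qf: "a < f" if "a \<in> set ?qs" for a using that as(2) set_drop_nth[OF as(3)] by auto
  have rp: "row s (as ! p) (rs ! p)" using as(1,3) by (rule list_all2_nthD)
  have pf: "as ! p < f" using as by simp
  define I where "I m s' \<longleftrightarrow> best_so_far b s' \<and> frame (v + 2) f s s' \<and> (\<forall>a<f. rarr s' a = rarr s a) \<and>
    row s' f ?T \<and> (\<forall>m'<m. row s' (f + 1 + m') (?E ! m'))" for m s'
  have 1: "wp ind ev (For (v + 2) (RPut f (IVar (v + 2)) (RDiv (RGet (as ! p) (IVar (v + 2)))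
            (RSub (RGet (as ! p) (IVar v)) (RGet (as ! p) (IVar (v + 1))))))) s (n * 3) (2 + n * 3) (I 0)"
  proof (rule wp_mono[OF wp_row[OF s, where r = ?T and q = 3 and v = v]])
    fix k and s' :: mem assume "1 \<le> k" "k \<le> n" "ivar s' = (ivar s)(v + 2 := k)" "\<And>a. a \<noteq> f \<Longrightarrow> rarr s' a = rarr s a"
    then show "rval (RDiv (RGet (as ! p) (IVar (v + 2))) (RSub (RGet (as ! p) (IVar v)) (RGet (as ! p) (IVar (v + 1))))) s' = ?T \<bullet> w k"
      using rp pf ij by (simp add: row_def pivot_def inner_diff_right)
  qed (use vf in \<open>auto simp: I_def\<close>)
  have 2: "wp ind ev (For (v + 2) (RPut (f + 1 + m) (IVar (v + 2))
            (RSub (RGet (?qs ! m) (IVar (v + 2)))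
              (RMul (RSub (RGet (?qs ! m) (IVar v)) (RGet (?qs ! m) (IVar (v + 1))))
                (RGet f (IVar (v + 2))))))) u (n * 3) (2 + n * 3) (I (Suc m))"
    if m: "m < length as - 1" and u: "I m u" for m u
  proof -
    have ub: "best_so_far b u" using u by (simp add: I_def)
    have q: "?qs ! m < f" using qf m lq by simp
    have "row s (?qs ! m) (drop_nth p rs ! m)" using qs m lq by (simp add: list_all2_nthD)
    then have rq: "row u (?qs ! m) (drop_nth p rs ! m)" using u q by (auto simp: I_def intro: row_cong)
    have Em: "?E ! m = drop_nth p rs ! m - (drop_nth p rs ! m \<bullet> ?g) *\<^sub>R ?T"
      using m lr as(3) by (simp add: eliminate_def length_drop_nth)
    have uv: "ivar u v = i" "ivar u (v + 1) = j" using u ij vf by (auto simp: I_def frame_def)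
    show ?thesis
    proof (rule wp_mono[OF wp_row[OF ub, where r = "?E ! m" and q = 3 and v = v]])
      fix k and s' :: mem assume "1 \<le> k" "k \<le> n" "ivar s' = (ivar u)(v + 2 := k)" "\<And>a. a \<noteq> f + 1 + m \<Longrightarrow> rarr s' a = rarr u a"
      then show "rval (RSub (RGet (?qs ! m) (IVar (v + 2)))
              (RMul (RSub (RGet (?qs ! m) (IVar v)) (RGet (?qs ! m) (IVar (v + 1))))
                (RGet f (IVar (v + 2))))) s' = ?E ! m \<bullet> w k"
        using rq q uv ij u by (simp add: Em I_def row_def inner_diff_right inner_diff_left)
    next
      fix s' assume s': "best_so_far b s' \<and> frame (v + 2) (f + 1 + m) u s' \<and>
        (\<forall>a. a \<noteq> f + 1 + m \<longrightarrow> rarr s' a = rarr u a) \<and> row s' (f + 1 + m) (?E ! m)"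
      have "frame (v + 2) f s s'"
        using u s' frame_mono[of "v + 2" "f + 1 + m" u s' "v + 2" f] by (auto simp: I_def intro: frame_trans)
      moreover have "row s' (f + 1 + m') (?E ! m')" if "m' < Suc m" for m'
        using that u s' by (cases "m' = m") (auto simp: I_def intro: row_cong)
      moreover have "row s' f ?T" using u s' by (auto simp: I_def intro: row_cong)
      ultimately show "I (Suc m) s'" using u s' by (auto simp: I_def)
    qed (use vf in auto)
  qed
  have fin: "list_all2 (row s') [f + 1..<f + length as] ?E" if "I (length as - 1) s'" for s'
    using that lq as(3) by (auto simp: I_def list_all2_conv_all_nth)
  have "wp ind ev (Seqs (map (\<lambda>m. For (v + 2) (RPut (f + 1 + m) (IVar (v + 2))
            (RSub (RGet (drop_nth p as ! m) (IVar (v + 2)))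
              (RMul (RSub (RGet (drop_nth p as ! m) (IVar v)) (RGet (drop_nth p as ! m) (IVar (v + 1))))
                (RGet f (IVar (v + 2))))))) [0..<length as - 1])) u ((length as - 1) * (n * 3))
          (1 + (length as - 1) * (2 + n * 3)) (I (length as - 1))" if "I 0 u" for u
    by (rule wp_Seqs[where I = I and q = "n * 3" and t = "2 + n * 3"]) (use that 2 in auto)
  from wp_SEQ[OF 1 this]
  have "wp ind ev (Eliminate p as f v) s (n * 3 + (length as - 1) * (n * 3))
     (2 + n * 3 + (1 + (length as - 1) * (2 + n * 3))) (I (length as - 1))"
    unfolding Eliminate_def by blast
  then show ?thesis
  proof (rule wp_mono)
    \<comment> \<open>The pivot and the \<open>length as - 1\<close> projected rows make
      \<open>length as\<close> fills, with at most 3 operations per cell.\<close>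
    have "n * 3 + (length as - 1) * (n * 3) = length as * (n * 3)"
      using as(3) by (cases "length as") auto
    then show "n * 3 + (length as - 1) * (n * 3) \<le> d * (n * 3)" using len by (metis mult_le_mono1)
    have "2 + n * 3 + (length as - 1) * (2 + n * 3) = length as * (2 + n * 3)"
      using as(3) by (cases "length as") auto
    moreover have "length as * (2 + n * 3) \<le> d * (2 + n * 3)" using len by (rule mult_le_mono1)
    ultimately show "2 + n * 3 + (1 + (length as - 1) * (2 + n * 3)) \<le> 1 + d * (2 + n * 3)" by linarith
  qed (use fin in \<open>auto simp: I_def\<close>)
qed

text \<open>All choices of pivot row and ordered pair are tried, and \<open>chamber_inv_step\<close>
  guarantees that one of them continues the flag; the others leave a stored optimum intact. The
  condition \<open>1 \<le> n\<close> reflects that for \<open>n = 0\<close> the pair loops are empty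
  and a node above the leaves visits nothing.\<close>

lemma wp_Node:
  assumes "best_so_far b s" "length as = Suc k" "length as + length ks = d"
    and "list_all2 (row s) as rs" "list_all2 (row s) ks vs"
    and "\<And>a. a \<in> set as \<union> set ks \<Longrightarrow> a < f \<and> (a < d \<or> d + 2 \<le> a)"
    and "10 \<le> v" "d + 2 \<le> f" and L: "n < 2 ^ L"
  shows "wp (indep \<B>) (eval_oracle ix c) (Node d k as ks f v) s (node_queries d k n L) (node_steps d k n L)
    (\<lambda>s'. frame v f s s' \<and> best_so_far (b \<or> 1 \<le> n \<and> chamber_inv D l rs vs) s')"
  using assms(1-8)
proof (induction k arbitrary: b s as ks rs vs f v)
  case (0 b s as ks rs vs f v)
  obtain a where a: "as = [a]" using 0 by (cases as) auto
  then obtain r where r: "rs = [r]" "row s a r" using 0 by (auto simp: list_all2_Cons1)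
  \<comment> \<open>The sign \<sigma> completes the flag: the keys now decide every normal positive
    at \<open>l\<close>.\<close>
  define G where "G \<sigma> \<longleftrightarrow> (\<forall>h\<in>D. l \<bullet> h > 0 \<longrightarrow> lexpos (of_int \<sigma> *\<^sub>R r # vs) h)" for \<sigma>
  let ?C = "\<lambda>\<sigma>. SEQ (For v (RPut f (IVar v) (RMul (RConst \<sigma>) (RGet (hd as) (IVar v))))) (Leaf d (f # ks))"
  have step: "wp (indep \<B>) (eval_oracle ix c) (?C \<sigma>) u (n + leaf_queries d n L) (2 + n * 3 + leaf_steps d n L)
      (\<lambda>s'. frame v f s s' \<and> best_so_far (b' \<or> G \<sigma>) s')"
    if u: "frame v f s u" "best_so_far b' u" for b' u \<sigma>
  proof (rule wp_SEQ)
    have same: "rarr u x = rarr s x" if "x \<in> set as \<union> set ks" for x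
      using 0(6)[OF that] u(1) by (auto simp: frame_def)
    show "wp (indep \<B>) (eval_oracle ix c) (For v (RPut f (IVar v) (RMul (RConst \<sigma>) (RGet (hd as) (IVar v))))) u
      (n * 1) (2 + n * 3) (\<lambda>s'. best_so_far b' s' \<and> frame v f u s' \<and> (\<forall>a. a \<noteq> f \<longrightarrow> rarr s' a = rarr u a) \<and>
        row s' f (of_int \<sigma> *\<^sub>R r))"
    proof (rule wp_row[OF u(2), where v = v])
      fix j and s' :: mem assume "1 \<le> j" "j \<le> n" "ivar s' = (ivar u)(v := j)" "\<And>x. x \<noteq> f \<Longrightarrow> rarr s' x = rarr u x"
      then show "rval (RMul (RConst \<sigma>) (RGet (hd as) (IVar v))) s' = (of_int \<sigma> *\<^sub>R r) \<bullet> w j"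
        using r(2) same[of a] 0(6)[of a] by (auto simp: a row_def)
    qed (use 0 in auto)
  next
    fix u' assume u': "best_so_far b' u' \<and> frame v f u u' \<and> (\<forall>a. a \<noteq> f \<longrightarrow> rarr u' a = rarr u a) \<and>
        row u' f (of_int \<sigma> *\<^sub>R r)"
    have "list_all2 (row u') ks vs"
      by (rule rows_cong[OF 0(5)]) (use u' u 0(6) in \<open>force simp: frame_def\<close>)
    then have rows: "list_all2 (row u') (f # ks) (of_int \<sigma> *\<^sub>R r # vs)" using u' by simp
    have G: "good_keys (map (rarr u') (f # ks))" if "G \<sigma>"
      unfolding good_keys_def
    proof (intro ballI impI)
      fix i j assume ij: "i \<in> {1..n}" "j \<in> {1..n}" "l \<bullet> w i < l \<bullet> w j"
      then have "w j - w i \<in> D" "l \<bullet> (w j - w i) > 0" by (auto simp: inner_diff_right)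
      then show "key_less (map (rarr u') (f # ks)) i j"
        using that key_less_lexpos[OF rows ij(1,2)] unfolding G_def by blast
    qed
    have "wp (indep \<B>) (eval_oracle ix c) (Leaf d (f # ks)) u' (leaf_queries d n L) (leaf_steps d n L)
       (\<lambda>s'. frame v f u' s' \<and> best_so_far (b' \<or> good_keys (map (rarr u') (f # ks))) s')"
      by (rule wp_Leaf) (use u' L 0 a in auto)
    then show "wp (indep \<B>) (eval_oracle ix c) (Leaf d (f # ks)) u' (leaf_queries d n L) (leaf_steps d n L)
       (\<lambda>s'. frame v f s s' \<and> best_so_far (b' \<or> G \<sigma>) s')"
    proof (rule wp_mono)
      fix s' assume s': "frame v f u' s' \<and> best_so_far (b' \<or> good_keys (map (rarr u') (f # ks))) s'"
      have "best_so_far (b' \<or> G \<sigma>) s'" by (rule best_so_far_mono[OF conjunct2[OF s']]) (use G in auto)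
      then show "frame v f s s' \<and> best_so_far (b' \<or> G \<sigma>) s'"
        using s' u' u by (blast intro: frame_trans)
    qed auto
  qed auto
  show ?case unfolding Node.simps
  proof (rule wp_Seqs[where I = "\<lambda>k s'. frame v f s s' \<and> best_so_far (b \<or> (\<exists>k'<k. G ([1, -1] ! k'))) s'"
        and q = "n + leaf_queries d n L" and t = "2 + n * 3 + leaf_steps d n L"])
    fix k u assume k: "k < length (map ?C [1, - 1])"
      and u: "frame v f s u \<and> best_so_far (b \<or> (\<exists>k'<k. G ([1, -1] ! k'))) u"
    have "wp (indep \<B>) (eval_oracle ix c) (?C ([1, -1] ! k)) u (n + leaf_queries d n L) (2 + n * 3 + leaf_steps d n L)
       (\<lambda>s'. frame v f s s' \<and> best_so_far (b \<or> (\<exists>k'<Suc k. G ([1, -1] ! k'))) s')"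
      by (rule wp_mono[OF step[OF conjunct1[OF u] conjunct2[OF u]]])
        (auto simp: less_Suc_eq elim!: best_so_far_mono)
    then show "wp (indep \<B>) (eval_oracle ix c) (map ?C [1, - 1] ! k) u (n + leaf_queries d n L) (2 + n * 3 + leaf_steps d n L)
       (\<lambda>s'. frame v f s s' \<and> best_so_far (b \<or> (\<exists>k'<Suc k. G ([1, -1] ! k'))) s')"
      using k by (simp only: nth_map length_map)
  next
    fix s' assume s': "frame v f s s' \<and> best_so_far (b \<or> (\<exists>k'<length (map ?C [1, - 1]). G ([1, -1] ! k'))) s'"
    have "\<exists>k'<2. G ([1, -1] ! k')" if "chamber_inv D l rs vs"
    proof -
      from chamber_inv_single[of D l r vs] that r(1) have "G 1 \<or> G (-1)" by (auto simp: G_def)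
      moreover have "[1, -1::int] ! 0 = 1" "[1, -1::int] ! 1 = -1" "(0::nat) < 2" "(1::nat) < 2" by simp_all
      ultimately show ?thesis by metis
    qed
    then have "best_so_far (b \<or> 1 \<le> n \<and> chamber_inv D l rs vs) s'"
      by (intro best_so_far_mono[OF conjunct2[OF s']]) (auto simp: numeral_2_eq_2)
    then show "frame v f s s' \<and> best_so_far (b \<or> 1 \<le> n \<and> chamber_inv D l rs vs) s'" using s' by blast
  qed (use 0 in \<open>auto simp: frame_refl\<close>)
next
  case (Suc k b s as ks rs vs f v)
  define G where "G p g \<longleftrightarrow> chamber_inv D l (eliminate p g rs) (pivot p g rs # vs)" for p g
  let ?N = "Node d k [f + 1..<f + length as] (f # ks) (f + length as) (v + 3)"
  let ?B = "\<lambda>p. SEQ (Eliminate p as f v) ?N"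
  let ?q = "d * (n * 3) + node_queries d k n L" and ?t = "1 + d * (2 + n * 3) + node_steps d k n L"
  have body: "wp (indep \<B>) (eval_oracle ix c) (?B p) u ?q ?t
      (\<lambda>s'. frame v f s s' \<and> ivar s' v = i \<and> ivar s' (v + 1) = j \<and> best_so_far (b' \<or> G p (w i - w j)) s')"
    if u: "frame v f s u" "best_so_far b' u" and p: "p < length as" and
      ij: "ivar u v = i" "ivar u (v + 1) = j" "i \<in> {1..n}" "j \<in> {1..n}" for b' u p i j
  proof (rule wp_SEQ)
    have same: "rarr u x = rarr s x" if "x \<in> set as \<union> set ks" for x
      using Suc.prems(6)[OF that] u(1) by (auto simp: frame_def)
    have as: "list_all2 (row u) as rs" using Suc.prems(4) by (rule rows_cong) (use same in auto)
    show "wp (indep \<B>) (eval_oracle ix c) (Eliminate p as f v) u (d * (n * 3)) (1 + d * (2 + n * 3))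
    (\<lambda>s'. best_so_far b' s' \<and> frame (v + 2) f u s' \<and> (\<forall>a<f. rarr s' a = rarr u a) \<and>
      row s' f (pivot p (w i - w j) rs) \<and>
      list_all2 (row s') [f + 1..<f + length as] (eliminate p (w i - w j) rs))"
      by (rule wp_Eliminate[OF u(2) as _ p ij]) (use Suc.prems in auto)
    fix u' assume u': "best_so_far b' u' \<and> frame (v + 2) f u u' \<and> (\<forall>a<f. rarr u' a = rarr u a) \<and>
      row u' f (pivot p (w i - w j) rs) \<and>
      list_all2 (row u') [f + 1..<f + length as] (eliminate p (w i - w j) rs)"
    have "list_all2 (row u') ks vs" using Suc.prems(5)
      by (rule rows_cong) (use u' same Suc.prems(6) in auto)
    then have "wp (indep \<B>) (eval_oracle ix c) ?N u' (node_queries d k n L) (node_steps d k n L)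
       (\<lambda>s'. frame (v + 3) (f + length as) u' s' \<and> best_so_far (b' \<or> 1 \<le> n \<and> G p (w i - w j)) s')"
      unfolding G_def using u' Suc.prems by (intro Suc.IH) (auto, force+)
    then show "wp (indep \<B>) (eval_oracle ix c) ?N u' (node_queries d k n L) (node_steps d k n L)
       (\<lambda>s'. frame v f s s' \<and> ivar s' v = i \<and> ivar s' (v + 1) = j \<and> best_so_far (b' \<or> G p (w i - w j)) s')"
    proof (rule wp_mono)
      fix s' assume s': "frame (v + 3) (f + length as) u' s' \<and> best_so_far (b' \<or> 1 \<le> n \<and> G p (w i - w j)) s'"
      have "frame v f u u'" "frame v f u' s'" using u' s' by (auto intro: frame_mono)
      moreover have "ivar s' v = i" "ivar s' (v + 1) = j"
        using u' s' ij Suc.prems(7) by (auto simp: frame_def)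
      moreover have "best_so_far (b' \<or> G p (w i - w j)) s'"
        by (rule best_so_far_mono[OF conjunct2[OF s']]) (use ij in auto)
      ultimately show "frame v f s s' \<and> ivar s' v = i \<and> ivar s' (v + 1) = j \<and> best_so_far (b' \<or> G p (w i - w j)) s'"
        using u by (blast intro: frame_trans)
    qed auto
  qed auto
  have frame_put: "frame v f s (put_ivar y a u)" if "frame v f s u" "v \<le> y" for y a u
    using that Suc.prems(7) by (auto simp: frame_def)
  have best_put: "best_so_far b' (put_ivar y a u)" if "best_so_far b' u" "v \<le> y" for y a u b'
    by (rule best_so_far_cong[OF that(1)]) (use that(2) Suc.prems(7) in auto)
  have n0: "ivar u 0 = n" if "best_so_far b' u" for b' u using that by (simp add: best_so_far_def)
  \<comment> \<open>The three invariants follow the three nested iterations, over \<open>p\<close>,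
    \<open>i\<close> and \<open>j\<close>. Each records whether some choice already visited
    continues the flag.\<close>
  define I1 where "I1 p s' \<longleftrightarrow> frame v f s s' \<and> best_so_far (b \<or> (\<exists>p'<p. \<exists>g\<in>D. G p' g)) s'" for p s'
  define I2 where "I2 p i s' \<longleftrightarrow> frame v f s s' \<and>
    best_so_far (b \<or> (\<exists>p'<p. \<exists>g\<in>D. G p' g) \<or> (\<exists>i'\<in>{1..<i}. \<exists>j\<in>{1..n}. G p (w i' - w j))) s'" for p i s'
  define I3 where "I3 p i j s' \<longleftrightarrow> frame v f s s' \<and> ivar s' v = i \<and>
    best_so_far (b \<or> (\<exists>p'<p. \<exists>g\<in>D. G p' g) \<or> (\<exists>i'\<in>{1..<i}. \<exists>j\<in>{1..n}. G p (w i' - w j)) \<or>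
      (\<exists>j'\<in>{1..<j}. G p (w i - w j'))) s'" for p i j s'
  have set_n: "{1..<Suc n} = {1..n}" by auto
  have inner: "wp (indep \<B>) (eval_oracle ix c) (For (v + 1) (?B p)) u (n * ?q) (2 + n * (?t + 2))
     (\<lambda>s'. ivar s' v = i \<and> ivar s' 0 = n \<and> I2 p (Suc i) (put_ivar v (Suc i) s'))"
    if u: "I2 p i u" "ivar u v = i" and p: "p < length as" and i: "1 \<le> i" "i \<le> n" for p i u
  proof (rule wp_For[where I = "I3 p i" and n = n and q = ?q and t = ?t])
    show "ivar u 0 = n" using u n0 by (auto simp: I2_def)
    have "best_so_far (b \<or> (\<exists>p'<p. \<exists>g\<in>D. G p' g) \<or> (\<exists>i'\<in>{1..<i}. \<exists>j\<in>{1..n}. G p (w i' - w j))) (put_ivar (v + 1) 1 u)"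
      using u by (intro best_put) (auto simp: I2_def)
    then show "I3 p i 1 (put_ivar (v + 1) 1 u)" using u by (auto simp: I3_def I2_def frame_put)
  next
    fix j u' assume j: "1 \<le> j" "j \<le> n" "I3 p i j u'" "ivar u' (v + 1) = j" "ivar u' 0 = n"
    let ?b = "b \<or> (\<exists>p'<p. \<exists>g\<in>D. G p' g) \<or> (\<exists>i'\<in>{1..<i}. \<exists>j\<in>{1..n}. G p (w i' - w j)) \<or>
      (\<exists>j'\<in>{1..<j}. G p (w i - w j'))"
    have u': "frame v f s u'" "best_so_far ?b u'" "ivar u' v = i" using j(3) by (auto simp: I3_def)
    show "wp (indep \<B>) (eval_oracle ix c) (?B p) u' ?q ?t
       (\<lambda>s'. ivar s' (v + 1) = j \<and> ivar s' 0 = n \<and> I3 p i (Suc j) (put_ivar (v + 1) (Suc j) s'))"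
    proof (rule wp_mono[OF body[OF u'(1,2) p u'(3) j(4)]])
      fix s' assume s': "frame v f s s' \<and> ivar s' v = i \<and> ivar s' (v + 1) = j \<and> best_so_far (?b \<or> G p (w i - w j)) s'"
      have "best_so_far (b \<or> (\<exists>p'<p. \<exists>g\<in>D. G p' g) \<or> (\<exists>i'\<in>{1..<i}. \<exists>j\<in>{1..n}. G p (w i' - w j)) \<or>
          (\<exists>j'\<in>{1..<Suc j}. G p (w i - w j'))) (put_ivar (v + 1) (Suc j) s')"
        by (rule best_put[OF best_so_far_mono[of "?b \<or> G p (w i - w j)"]])
          (use s' in \<open>auto simp: less_Suc_eq\<close>)
      then show "ivar s' (v + 1) = j \<and> ivar s' 0 = n \<and> I3 p i (Suc j) (put_ivar (v + 1) (Suc j) s')"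
        using s' n0 by (auto simp: I3_def frame_put)
    qed (use i j in auto)
  next
    fix u' assume u': "I3 p i (Suc n) u'"
    have set_i: "{1..<Suc i} = insert i {1..<i}" using i by auto
    from u' have best: "best_so_far (b \<or> (\<exists>p'<p. \<exists>g\<in>D. G p' g) \<or> (\<exists>i'\<in>{1..<i}. \<exists>j\<in>{1..n}. G p (w i' - w j)) \<or>
      (\<exists>j'\<in>{1..<Suc n}. G p (w i - w j'))) u'" by (simp add: I3_def)
    have "best_so_far (b \<or> (\<exists>p'<p. \<exists>g\<in>D. G p' g) \<or> (\<exists>i'\<in>{1..<Suc i}. \<exists>j\<in>{1..n}. G p (w i' - w j))) (put_ivar v (Suc i) u')"
      unfolding set_i by (rule best_put[OF best_so_far_mono[OF best]]) (unfold set_n, blast, simp)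
    then show "ivar u' v = i \<and> ivar u' 0 = n \<and> I2 p (Suc i) (put_ivar v (Suc i) u')"
      using u' n0 by (auto simp: I3_def I2_def frame_put)
  qed auto
  have outer: "wp (indep \<B>) (eval_oracle ix c) (For v (For (v + 1) (?B p))) u (n * (n * ?q))
       (2 + n * ((2 + n * (?t + 2)) + 2)) (I1 (Suc p))"
    if u: "I1 p u" and p: "p < length as" for p u
  proof (rule wp_For[where I = "I2 p" and n = n and q = "n * ?q" and t = "2 + n * (?t + 2)"])
    show "v \<noteq> 0" using Suc.prems(7) by simp
    show "ivar u 0 = n" using u n0 by (auto simp: I1_def)
    have "best_so_far (b \<or> (\<exists>p'<p. \<exists>g\<in>D. G p' g)) (put_ivar v 1 u)"
      using u by (intro best_put) (auto simp: I1_def)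
    then show "I2 p 1 (put_ivar v 1 u)" using u by (auto simp: I1_def I2_def frame_put)
  next
    fix u' assume u': "I2 p (Suc n) u'"
    then have best: "best_so_far (b \<or> (\<exists>p'<p. \<exists>g\<in>D. G p' g) \<or> (\<exists>i'\<in>{1..<Suc n}. \<exists>j\<in>{1..n}. G p (w i' - w j))) u'"
      by (simp add: I2_def)
    have "best_so_far (b \<or> (\<exists>p'<Suc p. \<exists>g\<in>D. G p' g)) u'"
      by (rule best_so_far_mono[OF best]) (unfold set_n, force simp: less_Suc_eq)
    then show "I1 (Suc p) u'" using u' by (auto simp: I1_def I2_def)
  qed (use p inner in auto)
  have la: "length as \<le> d" using Suc.prems(3) by simp
  show ?case unfolding Node.simps
  proof (rule wp_Seqs[where I = I1 and q = "n * (n * ?q)" and t = "2 + n * ((2 + n * (?t + 2)) + 2)"])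
    show "I1 0 s" using Suc.prems(1) by (auto simp: I1_def frame_refl)
  next
    fix s' assume s': "I1 (length (map (\<lambda>p. For v (For (v + 1) (?B p))) [0..<length as])) s'"
    have "\<exists>p<length as. \<exists>g\<in>D. G p g" if n: "1 \<le> n" and inv: "chamber_inv D l rs vs"
    proof -
      have lr: "length rs = length as" using Suc.prems(4) list_all2_lengthD by fastforce
      have "finite D" by simp
      \<comment> \<open>The dummy normal is \<open>w 1 - w 1\<close>, which requires a nonempty
        ground set.\<close>
      moreover have "0 \<in> D" using n by (force intro!: image_eqI[of _ _ "(1, 1)"])
      moreover have "- h \<in> D" if "h \<in> D" for h using that by force
      moreover have "rs \<noteq> []" using lr Suc.prems(2) by auto
      ultimately show ?thesis using chamber_inv_step[OF _ _ _ inv] unfolding G_def lr by metis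
    qed
    then have ex: "b \<or> (\<exists>p<length as. \<exists>g\<in>D. G p g)" if "b \<or> 1 \<le> n \<and> chamber_inv D l rs vs"
      using that by metis
    have s'': "frame v f s s'" "best_so_far (b \<or> (\<exists>p<length as. \<exists>g\<in>D. G p g)) s'"
      using s' unfolding I1_def by simp_all
    show "frame v f s s' \<and> best_so_far (b \<or> 1 \<le> n \<and> chamber_inv D l rs vs) s'"
      using s''(1) best_so_far_mono[OF s''(2) ex] by blast
  next
    show "length (map (\<lambda>p. For v (For (v + 1) (?B p))) [0..<length as]) * (n * (n * ?q)) \<le> node_queries d (Suc k) n L"
      using la by (simp add: mult_le_mono1)
    show "1 + length (map (\<lambda>p. For v (For (v + 1) (?B p))) [0..<length as]) * (2 + n * ((2 + n * (?t + 2)) + 2))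
      \<le> node_steps d (Suc k) n L"
      unfolding node_steps.simps length_map length_upt using la by (intro add_left_mono mult_le_mono1) simp
  next
    fix p u assume p: "p < length (map (\<lambda>p. For v (For (v + 1) (?B p))) [0..<length as])" and u: "I1 p u"
    then have pl: "p < length as" by simp
    then have "map (\<lambda>p. For v (For (v + 1) (?B p))) [0..<length as] ! p = For v (For (v + 1) (?B p))"
      by simp
    then show "wp (indep \<B>) (eval_oracle ix c) (map (\<lambda>p. For v (For (v + 1) (?B p))) [0..<length as] ! p) u
        (n * (n * ?q)) (2 + n * ((2 + n * (?t + 2)) + 2)) (I1 (Suc p))"
      using outer[OF u pl] by (simp only:)
  qed
qed

end

section \<open>The algorithm and its complexity\<close>

text \<open>Exposing \<open>v\<close> amounts to finitely many strict inequalities, which survive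
  the perturbation that makes the functional nonzero on every nonzero element of
  \<open>D\<close>.\<close>

lemma exists_generic_functional:
  fixes w :: "nat \<Rightarrow> 'a::euclidean_space"
  assumes M: "matroid N \<B>" and "convex_on UNIV c" and D: "finite D"
  shows "\<exists>l. (\<forall>h\<in>D. l \<bullet> h = 0 \<longrightarrow> h = 0) \<and>
    (\<forall>B\<in>\<B>. (\<forall>A\<in>\<B>. l \<bullet> sum w A \<le> l \<bullet> sum w B) \<longrightarrow> (\<forall>A\<in>\<B>. c (sum w A) \<le> c (sum w B)))"
proof -
  let ?S = "sum w ` \<B>"
  have S: "finite ?S" "?S \<noteq> {}" using matroid_finite(1)[OF M] M by (auto simp: matroid_def)
  obtain v l where v: "v \<in> ?S" "\<forall>y\<in>?S. c y \<le> c v" and l: "\<forall>y\<in>?S - {v}. l \<bullet> (v - y) > 0"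
    using convex_max_exposed[OF S assms(2)] by metis
  have "\<exists>l'\<in>UNIV. (\<forall>h\<in>D - {0}. l' \<bullet> h \<noteq> 0) \<and> (\<forall>p\<in>(\<lambda>y. v - y) ` (?S - {v}). l' \<bullet> p > 0)"
  proof (rule generic_perturb[where a = l])
    show "\<forall>h\<in>D - {0}. \<exists>u\<in>UNIV. u \<bullet> h \<noteq> 0"
      using inner_eq_zero_iff by blast
  qed (use D S l in auto)
  then obtain l' where l': "\<forall>h\<in>D - {0}. l' \<bullet> h \<noteq> 0" "\<forall>y\<in>?S - {v}. l' \<bullet> (v - y) > 0" by auto
  have "\<forall>A\<in>\<B>. c (sum w A) \<le> c (sum w B)"
    if B: "B \<in> \<B>" "\<forall>A\<in>\<B>. l' \<bullet> sum w A \<le> l' \<bullet> sum w B" for B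
  proof -
    have "l' \<bullet> v \<le> l' \<bullet> sum w B" using B v(1) by auto
    moreover have "l' \<bullet> (v - sum w B) > 0" if "sum w B \<noteq> v" using l'(2) B(1) that by blast
    \<comment> \<open>Several bases may have the weight \<open>v\<close>; only the point is unique,
      and that is all \<open>c\<close> depends on.\<close>
    ultimately have "sum w B = v" unfolding inner_diff_right by linarith
    then show ?thesis using v(2) by auto
  qed
  then show ?thesis using l' by blast
qed

text \<open>Input array \<open>a\<close> already is the row of a unit vector, so the enumeration
  starts from the whole space without any preparation. The free arrays begin after the
  \<open>d + 2\<close> reserved ones, the free variables at 10.\<close>

definition Optimize :: "nat \<Rightarrow> com" where
  "Optimize d = Node d (d - 1) [0..<d] [] (d + 2) 10"

lemma solves_Optimize:
  fixes ix :: "'d::finite \<Rightarrow> nat" and w :: "nat \<Rightarrow> real ^ 'd"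
  assumes ix: "bij_betw ix UNIV {..<CARD('d)}" and M: "matroid {1..n} \<B>" and c: "convex_on UNIV c"
    and L: "n < 2 ^ L"
  shows "solves_within ix (Optimize CARD('d)) n \<B> w c
    (node_queries CARD('d) (CARD('d) - 1) n L) (node_steps CARD('d) (CARD('d) - 1) n L)"
proof -
  let ?d = "CARD('d)" and ?D = "(\<lambda>(i,j). w i - w j) ` ({1..n} \<times> {1..n})"
  have "finite ?D" by simp
  from exists_generic_functional[OF M c this, where w = w] obtain l where
    gen: "\<forall>h\<in>?D. l \<bullet> h = 0 \<longrightarrow> h = 0"
    and opt: "\<forall>B\<in>\<B>. (\<forall>A\<in>\<B>. l \<bullet> sum w A \<le> l \<bullet> sum w B) \<longrightarrow> (\<forall>A\<in>\<B>. c (sum w A) \<le> c (sum w B))"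
    by blast
  interpret convex_matroid_problem ix ?d n \<B> w c l
    by unfold_locales (use ix M opt in \<open>auto simp: optimal_basis_def\<close>)
  let ?rs = "map (\<lambda>a. axis (inv ix a) 1) [0..<?d] :: (real ^ 'd) list"
  let ?s = "init_mem ix n w"
  have d: "?d \<ge> 1" by (simp add: Suc_leI)
  have "inv ix ` {..<?d} = UNIV" using ix by (metis bij_betw_def image_inv_f_f)
  moreover have "set ?rs = (\<lambda>i. axis i 1) ` (inv ix ` {..<?d})"
    by (simp add: image_image atLeast0LessThan)
  ultimately have "set ?rs = range (\<lambda>i. axis i 1)" by (simp only:)
  then have "set ?rs = Basis" by (auto simp: Basis_vec_def)
  then have "l \<in> span (set ?rs)" by simp
  \<comment> \<open>The initial face is the whole space, with \<open>l\<close> itself as its point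
    \<open>m\<close>; genericity makes \<open>l \<bullet> h = 0\<close> force
    \<open>h = 0\<close>.\<close>
  then have inv: "chamber_inv ?D l ?rs []" unfolding chamber_inv_def using gen by (intro bexI[of _ l]) fastforce+
  have "best_so_far False ?s" by (simp add: best_so_far_def init_mem_def iarr_set_def)
  moreover have "list_all2 (row ?s) [0..<?d] ?rs"
    by (auto simp: list_all2_conv_all_nth row_def init_mem_def inner_axis' )
  ultimately have "wp (indep \<B>) (eval_oracle ix c) (Optimize ?d) ?s (node_queries ?d (?d - 1) n L)
      (node_steps ?d (?d - 1) n L)
      (\<lambda>s'. frame 10 (?d + 2) ?s s' \<and> best_so_far (False \<or> 1 \<le> n \<and> chamber_inv ?D l ?rs []) s')"
    unfolding Optimize_def using d L by (intro wp_Node) auto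
  moreover have "optimal_basis \<B> w c (iarr_set 0 s)"
    if s: "best_so_far (False \<or> 1 \<le> n \<and> chamber_inv ?D l ?rs []) s" for s
  \<comment> \<open>For \<open>n = 0\<close> possibly no leaf is reached; array 0 is then still
    empty, and the empty set is the only basis.\<close>
  proof (cases "n = 0")
    case True
    then have "\<B> = {{}}" using M by (auto simp: matroid_def)
    moreover have "iarr_set 0 s = {} \<or> iarr_set 0 s \<in> \<B>"
      using s unfolding best_so_far_def by presburger
    ultimately show ?thesis by (auto simp: optimal_basis_def)
  next
    case False
    then have "False \<or> 1 \<le> n \<and> chamber_inv ?D l ?rs []" using inv by simp
    then show ?thesis using s unfolding best_so_far_def by presburger
  qed
  ultimately show ?thesis unfolding solves_within_def wp_def by blast
qed

section \<open>Growth of the cost recurrences\<close>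

lemma bigo_ln_aux:
  "(\<lambda>n. 1) \<in> O(\<lambda>n. ln (real n))"
  "(\<lambda>n. real (nat \<lceil>log 2 (real n + 1)\<rceil>)) \<in> O(\<lambda>n. ln (real n))"
proof -
  show "(\<lambda>n. 1) \<in> O(\<lambda>n. ln (real n))" by real_asymp
  have "(\<lambda>n. real (nat \<lceil>log 2 (real n + 1)\<rceil>)) \<in> O(\<lambda>n. log 2 (real n + 1) + 1)"
  proof (rule landau_o.big_mono, rule always_eventually, rule allI)
    fix n :: nat
    have "0 \<le> log 2 (real n + 1)" by simp
    moreover from this have "0 \<le> real_of_int \<lceil>log 2 (real n + 1)\<rceil>" by (rule order_trans) (rule le_of_int_ceiling)
    moreover have "real_of_int \<lceil>log 2 (real n + 1)\<rceil> \<le> log 2 (real n + 1) + 1"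
      by (rule of_int_ceiling_le_add_one)
    ultimately show "norm (real (nat \<lceil>log 2 (real n + 1)\<rceil>)) \<le> norm (log 2 (real n + 1) + 1)" by simp
  qed
  also have "(\<lambda>n. log 2 (real n + 1) + 1) \<in> O(\<lambda>n. ln (real n))" by real_asymp
  finally show "(\<lambda>n. real (nat \<lceil>log 2 (real n + 1)\<rceil>)) \<in> O(\<lambda>n. ln (real n))" .
qed

text \<open>A leaf costs O(n log n), and each level multiplies by \<open>d * n * n\<close>. The
  eliminations of a level add a term of order \<open>n ^ 3\<close>, which the exponent
  \<open>2 * Suc k + 1 \<ge> 3\<close> absorbs.\<close>

lemma node_queries_bigo:
  fixes L :: "nat \<Rightarrow> nat"
  assumes L: "(\<lambda>n. real (L n)) \<in> O(\<lambda>n. ln (real n))"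
  shows "(\<lambda>n. real (node_queries d k n (L n))) \<in> O(\<lambda>n. real n ^ (2 * k + 1) * ln (real n))"
proof (induction k)
  case 0
  have 1: "(\<lambda>n. real n * real (L n)) \<in> O(\<lambda>n. real n * ln (real n))"
    using L by (intro landau_o.big.mult) auto
  have 2: "(\<lambda>n. real n) \<in> O(\<lambda>n. real n * ln (real n))" "(\<lambda>n. 1) \<in> O(\<lambda>n. real n * ln (real n))"
    by real_asymp+
  have "(\<lambda>n. 4 * real d * (real n * real (L n)) + (4 + 2 * real d) * real n + 4 * 1) \<in> O(\<lambda>n. real n * ln (real n))"
    using 1 2 by (intro sum_in_bigo) auto
  moreover have "(\<lambda>n. real (node_queries d 0 n (L n))) =
      (\<lambda>n. 4 * real d * (real n * real (L n)) + (4 + 2 * real d) * real n + 4 * 1)"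
    by (rule ext) (simp add: leaf_queries_def algebra_simps)
  ultimately show ?case by simp
next
  case (Suc k)
  let ?g = "\<lambda>n. real n ^ (2 * Suc k + 1) * ln (real n)"
  have "(\<lambda>n. (real n * real n) * real (node_queries d k n (L n))) \<in>
      O(\<lambda>n. (real n * real n) * (real n ^ (2 * k + 1) * ln (real n)))"
    using Suc by (intro landau_o.big.mult) auto
  moreover have "(\<lambda>n. (real n * real n) * (real n ^ (2 * k + 1) * ln (real n))) = ?g"
    by (simp add: fun_eq_iff)
  ultimately have 1: "(\<lambda>n. (real n * real n) * real (node_queries d k n (L n))) \<in> O(?g)" by simp
  \<comment> \<open>From 3 on the logarithm is at least 1, because
    \<open>exp 1 \<le> 3\<close>.\<close>
  have 2: "(\<lambda>n. real n ^ 3) \<in> O(?g)"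
  proof (rule landau_o.big_mono, rule eventually_sequentiallyI[of 3])
    fix n :: nat assume n: "3 \<le> n"
    have "real n ^ 3 * 1 \<le> real n ^ (2 * Suc k + 1) * ln (real n)"
    proof (rule mult_mono)
      show "real n ^ 3 \<le> real n ^ (2 * Suc k + 1)" using n by (intro power_increasing) auto
      have "exp 1 \<le> real n" using n exp_le by linarith
      then show "1 \<le> ln (real n)" using n by (simp add: ln_ge_iff)
    qed auto
    then show "norm (real n ^ 3) \<le> norm (?g n)" using n by simp
  qed
  have "(\<lambda>n. (3 * real d * real d) * real n ^ 3 + real d * ((real n * real n) * real (node_queries d k n (L n)))) \<in> O(?g)"
    using 1 2 by (intro sum_in_bigo) auto
  moreover have "(\<lambda>n. real (node_queries d (Suc k) n (L n))) =
     (\<lambda>n. (3 * real d * real d) * real n ^ 3 + real d * ((real n * real n) * real (node_queries d k n (L n))))"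
    by (rule ext) (simp add: algebra_simps power3_eq_cube)
  ultimately show ?case by simp
qed

text \<open>Hiding the exponent makes the notion closed under sum and product, so the step bound
  follows from the shape of its recurrence alone.\<close>

definition poly_bounded :: "(nat \<Rightarrow> nat) \<Rightarrow> bool" where
  "poly_bounded f \<longleftrightarrow> (\<exists>k. (\<lambda>n. real (f n)) \<in> O(\<lambda>n. real n ^ k))"

lemma poly_bounded_const: "poly_bounded (\<lambda>n. a)"
  unfolding poly_bounded_def by (rule exI[of _ 0]) simp

lemma poly_bounded_id: "poly_bounded (\<lambda>n. n)"
  unfolding poly_bounded_def by (rule exI[of _ 1]) simp

lemma poly_bounded_add: "poly_bounded f \<Longrightarrow> poly_bounded g \<Longrightarrow> poly_bounded (\<lambda>n. f n + g n)"
proof -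
  assume "poly_bounded f" "poly_bounded g"
  then obtain j k where f: "(\<lambda>n. real (f n)) \<in> O(\<lambda>n. real n ^ j)" and g: "(\<lambda>n. real (g n)) \<in> O(\<lambda>n. real n ^ k)"
    unfolding poly_bounded_def by blast
  have up: "(\<lambda>n. real n ^ i) \<in> O(\<lambda>n. real n ^ max j k)" if "i \<le> max j k" for i
  proof (rule landau_o.big_mono, rule eventually_sequentiallyI[of 1])
    fix n :: nat assume "1 \<le> n"
    then show "norm (real n ^ i) \<le> norm (real n ^ max j k)" using that by (simp add: power_increasing)
  qed
  have "(\<lambda>n. real (f n) + real (g n)) \<in> O(\<lambda>n. real n ^ max j k)"
    by (intro sum_in_bigo landau_o.big_trans[OF f up] landau_o.big_trans[OF g up]) auto
  then show ?thesis unfolding poly_bounded_def by auto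
qed

lemma poly_bounded_mult: "poly_bounded f \<Longrightarrow> poly_bounded g \<Longrightarrow> poly_bounded (\<lambda>n. f n * g n)"
proof -
  assume "poly_bounded f" "poly_bounded g"
  then obtain j k where "(\<lambda>n. real (f n)) \<in> O(\<lambda>n. real n ^ j)" "(\<lambda>n. real (g n)) \<in> O(\<lambda>n. real n ^ k)"
    unfolding poly_bounded_def by blast
  from landau_o.big.mult[OF this] show ?thesis
    unfolding poly_bounded_def by (intro exI[of _ "j + k"]) (simp add: power_add)
qed

lemmas poly_bounded_intros = poly_bounded_const poly_bounded_id poly_bounded_add poly_bounded_mult

lemma node_steps_poly_bounded:
  assumes "poly_bounded L"
  shows "poly_bounded (\<lambda>n. node_steps d k n (L n))"
proof (induction k)
  case 0
  show ?case unfolding node_steps.simps leaf_steps_def by (intro poly_bounded_intros assms)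
next
  case (Suc k)
  show ?case unfolding node_steps.simps by (intro poly_bounded_intros Suc)
qed

theorem theorem1p4:
  fixes ix :: "'d::finite \<Rightarrow> nat"
  assumes "bij_betw ix UNIV {..<CARD('d)}"
  shows "\<exists>(P :: com) (T :: nat \<Rightarrow> nat) (S :: nat \<Rightarrow> nat) (k :: nat).
    (\<lambda>n. real (T n)) \<in> O(\<lambda>n. real n ^ (2 * CARD('d) - 1) * ln (real n)) \<and>
    (\<lambda>n. real (S n)) \<in> O(\<lambda>n. real n ^ k) \<and>
    (\<forall>(n :: nat) (\<B> :: nat set set) (w :: nat \<Rightarrow> real ^ 'd) (c :: real ^ 'd \<Rightarrow> real).
       matroid {1..n} \<B> \<and> convex_on UNIV c \<longrightarrow>
       solves_within ix P n \<B> w c (T n) (S n))"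
proof -
  \<comment> \<open>This exponent satisfies \<open>n < 2 ^ L n\<close>, so \<open>L n\<close>
    halvings exhaust any interval of the binary search.\<close>
  define L where "L n = nat \<lceil>log 2 (real n + 1)\<rceil>" for n :: nat
  have L: "(\<lambda>n. real (L n)) \<in> O(\<lambda>n. ln (real n))" unfolding L_def by (rule bigo_ln_aux)
  have nL: "n < 2 ^ L n" for n
  proof -
    have "log 2 (real n + 1) \<le> real (L n)" unfolding L_def by linarith
    then have "real n + 1 \<le> 2 powr real (L n)" by (subst (asm) log_le_iff) auto
    also have "\<dots> = real (2 ^ L n)" by (simp add: powr_realpow)
    finally show ?thesis by linarith
  qed
  let ?d = "CARD('d)"
  \<comment> \<open>The \<open>d - 1\<close> levels contribute \<open>n ^ 2\<close> each, and the
    sort at a leaf one more factor \<open>n\<close> besides the logarithm.\<close>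
  have "2 * (?d - 1) + 1 = 2 * ?d - 1" using zero_less_card_finite[where 'a = 'd] by linarith
  then have T: "(\<lambda>n. real (node_queries ?d (?d - 1) n (L n))) \<in> O(\<lambda>n. real n ^ (2 * ?d - 1) * ln (real n))"
    using node_queries_bigo[OF L, of ?d "?d - 1"] by metis
  have "(\<lambda>n. ln (real n)) \<in> O(\<lambda>n. real n ^ 1)" by real_asymp
  then have "poly_bounded L" unfolding poly_bounded_def using landau_o.big_trans[OF L] by blast
  from node_steps_poly_bounded[OF this, of ?d "?d - 1"]
  obtain k where S: "(\<lambda>n. real (node_steps ?d (?d - 1) n (L n))) \<in> O(\<lambda>n. real n ^ k)"
    unfolding poly_bounded_def by blast
  show ?thesis
    by (intro exI conjI allI impI, rule T, rule S, rule solves_Optimize[OF assms _ _ nL]) auto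
qed

end
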